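(* Let $q\in(0,1)$ and $\alpha>-1$. Then for all $m,n\in\mathbb{N}_{0}$, the continuous $q$-Laguerre polynomials satisfy \[ \frac{(q;q)_{\infty}}{2\pi(q^{3/2};q)_{\infty}}\int_{0}^{\pi}P_{m}^{(\alpha)}(\cos\theta\,|\,q)\,P_{n}^{(\alpha)}(\cos\theta\,|\,q)\left|\frac{(e^{2\mathrm{i}\theta},q^{\frac34-\frac{\alpha}{2}}e^{\mathrm{i}\theta};q)_{\infty}}{(q^{\frac34+\frac{\alpha}{2}}e^{\mathrm{i}\theta};q)_{\infty}}\right|^{2}\mathrm{d}\theta =(-1)^{m+n}\,\frac{q^{(\alpha+1/2)(m+n)+m(m-1)/2+n(n-1)/2}}{(q;q)_{m}(q;q)_{n}}\;{}_{0}\phi_{1}\!\left(-;\,q^{3/2};\,q,\,q^{-m-n-\alpha+3/2}\right). \]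
   Context: For $q\in(0,1)$: $(c;q)_{n}:=\prod_{j=0}^{n-1}(1-cq^{j})$ for $n\in\mathbb{N}_0\cup\{\infty\}$ and $(c_{1},\dots,c_{p};q)_{n}:=(c_{1};q)_{n}\cdots(c_{p};q)_{n}$. The basic hypergeometric series used is \[ {}_{0}\phi_{1}(-;c;q,z)=\sum_{k=0}^{\infty}\frac{q^{k(k-1)}z^{k}}{(c;q)_{k}(q;q)_{k}}. \] The Al-Salam--Chihara polynomials are defined by $Q_{-1}(x;a,b\,|\,q)=0$, $Q_{0}(x;a,b\,|\,q)=1$ and, for $n\in\mathbb{N}_0$, \[ Q_{n+1}(x;a,b\,|\,q)=\left(2x-(a+b)q^{n}\right)Q_{n}(x;a,b\,|\,q)-(1-q^{n})(1-abq^{n-1})Q_{n-1}(x;a,b\,|\,q). \] The continuous $q$-Laguerre polynomials are \[ P_{n}^{(\alpha)}(x\,|\,q)=\frac{a^{n}}{(q;q)_{n}}\,Q_{n}(x;a,aq^{1/2}\,|\,q),\qquad a=q^{\alpha/2+1/4}. \] $\mathbb{N}_0=\{0,1,2,\dots\}$. *)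

theory Defs
  imports "HOL-Analysis.Analysis"
begin

definition qpoch :: "'a::real_normed_field \<Rightarrow> 'a \<Rightarrow> nat \<Rightarrow> 'a" where
  "qpoch c q n = (\<Prod>j<n. 1 - c * q ^ j)"

text \<open>\<^const>\<open>prodinf\<close> allows finitely many vanishing factors, in which case its value is 0.\<close>

definition qpoch_inf :: "'a::real_normed_field \<Rightarrow> 'a \<Rightarrow> 'a" where
  "qpoch_inf c q = (\<Prod>j. 1 - c * q ^ j)"

definition phi01 :: "real \<Rightarrow> real \<Rightarrow> real \<Rightarrow> real" where
  "phi01 c q z = (\<Sum>k. q ^ (k * (k - 1)) * z ^ k / (qpoch c q k * qpoch q q k))"

text \<open>The three-term recurrence is shifted by one. At index 0 the coefficient of the polynomial
  of index \<open>-1\<close> vanishes, which gives the second equation.\<close>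

fun al_salam_chihara :: "nat \<Rightarrow> real \<Rightarrow> real \<Rightarrow> real \<Rightarrow> real \<Rightarrow> real" where
  "al_salam_chihara 0 x a b q = 1"
| "al_salam_chihara (Suc 0) x a b q = 2 * x - (a + b)"
| "al_salam_chihara (Suc (Suc n)) x a b q =
     (2 * x - (a + b) * q ^ Suc n) * al_salam_chihara (Suc n) x a b q
     - (1 - q ^ Suc n) * (1 - a * b * q ^ n) * al_salam_chihara n x a b q"

definition cont_q_laguerre :: "nat \<Rightarrow> real \<Rightarrow> real \<Rightarrow> real \<Rightarrow> real" where
  "cont_q_laguerre n \<alpha> x q =
     (let a = q powr (\<alpha> / 2 + 1 / 4)
      in a ^ n / qpoch q q n * al_salam_chihara n x a (a * q powr (1 / 2)) q)"

end

theory Submission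
  imports Defs
begin

text \<open>
  Put \<open>a = q\<^bsup>\<alpha>/2+1/4\<^esup>\<close>, \<open>b = a q\<^bsup>1/2\<^esup>\<close>, \<open>c = q/a\<close>, so the weight is
  \<open>|(e\<^bsup>2i\<theta>\<^esup>, c e\<^bsup>i\<theta>\<^esup>)\<^sub>\<infinity> / (b e\<^bsup>i\<theta>\<^esup>)\<^sub>\<infinity>|\<^sup>2\<close>. Let \<open>J(b,c)\<close> be its normalised mass, with \<open>b\<close> and \<open>c\<close> independent.
  The three quadratics \<open>1 + b\<^sup>2 - 2bx\<close>, \<open>1 + c\<^sup>2 - 2cx\<close> and \<open>1\<close> are linearly dependent, which gives
  \<open>b J(b,c) = c J(bq,cq) + (b - c)(1 - bc) J(b,cq)\<close>. A power series in \<open>c\<close> satisfying this relation is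
  determined by \<open>J(b,0)\<close>, and \<open>J(b,0) = 1\<close> by the Jacobi triple product and the orthogonality of the
  continuous \<open>q\<close>-Hermite polynomials to \<open>1\<close>; hence \<open>J(b,c) = (bc)\<^sub>\<infinity> \<^sub>0\<phi>\<^sub>1(-;bc;q,c\<^sup>2)\<close>.

  The Christoffel relation
  \<open>(1 + b\<^sup>2 - 2bx) Q\<^sub>m(x;a,bq) = (1 - abq\<^sup>m) Q\<^sub>m(x;a,b) - b Q\<^sub>m\<^sub>+\<^sub>1(x;a,b)\<close> then yields the integral of a single
  \<open>Q\<^sub>m\<close> by induction, for every \<open>b\<close>. Expanding \<open>x Q\<^sub>m Q\<^sub>n\<close> with the recurrence in \<open>m\<close> and in \<open>n\<close> determines
  the integrals of \<open>Q\<^sub>m Q\<^sub>n\<close> from those with \<open>n = 0\<close>, and for \<open>b = a q\<^bsup>1/2\<^esup>\<close> the claimed formula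
  satisfies the same recurrence because of the \<open>q\<close>-difference equation of \<open>\<^sub>0\<phi>\<^sub>1(-;q\<^bsup>3/2\<^esup>;q,z)\<close>.
\<close>

section \<open>Infinite products and Euler's expansions\<close>

lemma qpoch_0 [simp]: "qpoch c q 0 = 1"
  by (simp add: qpoch_def)

lemma qpoch_Suc: "qpoch c q (Suc n) = qpoch c q n * (1 - c * q ^ n)"
  by (simp add: qpoch_def)

lemma qpoch_Suc_shift: "qpoch c q (Suc n) = (1 - c) * qpoch (c * q) q n"
  unfolding qpoch_def by (subst prod.lessThan_Suc_shift) (simp add: mult.assoc)

lemma qpoch_LIMSEQ:
  fixes c q :: "'a::{real_normed_field,banach}"
  assumes "norm q < 1"
  shows "(\<lambda>n. qpoch c q n) \<longlonglongrightarrow> qpoch_inf c q"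
proof -
  have "summable (\<lambda>j. norm (1 - c * q ^ j - 1))"
    using assms by (simp add: norm_mult norm_power summable_mult summable_geometric)
  then have "abs_convergent_prod (\<lambda>j. 1 - c * q ^ j)"
    using abs_convergent_prod_conv_summable by blast
  then have "convergent_prod (\<lambda>j. 1 - c * q ^ j)"
    by (rule abs_convergent_prod_imp_convergent_prod)
  then have "(\<lambda>n. \<Prod>j\<le>n. 1 - c * q ^ j) \<longlonglongrightarrow> qpoch_inf c q"
    unfolding qpoch_inf_def by (rule convergent_prod_LIMSEQ)
  then have "(\<lambda>n. qpoch c q (Suc n)) \<longlonglongrightarrow> qpoch_inf c q"
    by (simp add: qpoch_def lessThan_Suc_atMost)
  then show ?thesis
    by (simp only: filterlim_sequentially_Suc)
qed

lemma qpoch_inf_rec: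
  fixes c q :: "'a::{real_normed_field,banach}"
  assumes "norm q < 1"
  shows "qpoch_inf c q = (1 - c) * qpoch_inf (c * q) q"
proof -
  have "(\<lambda>n. qpoch c q (Suc n)) \<longlonglongrightarrow> (1 - c) * qpoch_inf (c * q) q"
    unfolding qpoch_Suc_shift by (intro tendsto_intros qpoch_LIMSEQ assms)
  then show ?thesis
    using LIMSEQ_unique LIMSEQ_Suc[OF qpoch_LIMSEQ[OF assms]] by blast
qed

lemma qpoch_of_real: "qpoch (of_real c) (of_real q) n = of_real (qpoch c q n)"
  by (simp add: qpoch_def)

lemma qpoch_q_nonzero:
  fixes q :: "'a::real_normed_field"
  assumes "norm q < 1"
  shows "qpoch q q n \<noteq> 0"
proof -
  have "1 \<noteq> q * q ^ j" for j
  proof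
    assume "1 = q * q ^ j"
    then have "norm q ^ Suc j = 1"
      by (metis norm_one norm_power power_Suc)
    moreover have "norm q ^ Suc j < 1"
      using assms power_less_one_iff[of "norm q" "Suc j"] by simp
    ultimately show False by simp
  qed
  then show ?thesis
    by (simp add: qpoch_def)
qed

section \<open>Euler's power series for (x;q)_inf and for its reciprocal\<close>

definition euler_coeff :: "'a::real_normed_field \<Rightarrow> nat \<Rightarrow> 'a" where
  "euler_coeff q n = (-1) ^ n * q ^ (n choose 2) / qpoch q q n"

lemma choose_two_0 [simp]: "0 choose 2 = 0"
  by (simp add: numeral_2_eq_2)

lemma choose_two_Suc: "Suc n choose 2 = n + (n choose 2)"
  by (simp add: numeral_2_eq_2)

lemma one_minus_qpow_nonzero:
  fixes q :: "'a::real_normed_field"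
  assumes "norm q < 1"
  shows "1 - q ^ Suc n \<noteq> 0"
  using qpoch_q_nonzero[OF assms, of "Suc n"] by (simp add: qpoch_Suc)

lemma euler_coeff_Suc:
  fixes q :: "'a::real_normed_field"
  assumes "norm q < 1"
  shows "euler_coeff q (Suc n) * (1 - q ^ Suc n) = - (q ^ n) * euler_coeff q n"
  using qpoch_q_nonzero[OF assms, of n] one_minus_qpow_nonzero[OF assms, of n]
  by (simp add: euler_coeff_def choose_two_Suc qpoch_Suc power_add field_simps)

text \<open>A limit l < 1 leaves room for a fixed d with l < d < 1; the ordinary ratio test applies
  from the index on at which r n < d.\<close>

lemma summable_ratio_tendsto_less_1:
  fixes f :: "nat \<Rightarrow> 'a::banach"
  assumes "\<And>n. norm (f (Suc n)) \<le> r n * norm (f n)" and "r \<longlonglongrightarrow> l" and "l < (1::real)"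
  shows "summable f"
proof -
  obtain d where d: "l < d" "d < 1"
    using assms(3) dense by blast
  then have "eventually (\<lambda>n. r n < d) sequentially"
    using assms(2) order_tendstoD by blast
  then obtain N where "\<And>n. n \<ge> N \<Longrightarrow> r n < d"
    by (auto simp: eventually_sequentially)
  then have "norm (f (Suc n)) \<le> d * norm (f n)" if "n \<ge> N" for n
    using assms(1)[of n] that by (meson less_imp_le mult_right_mono norm_ge_zero order_trans)
  then show ?thesis
    using d by (rule_tac summable_ratio_test[where c = d and N = N])
qed

text \<open>A lower bound uniform in n: it makes the ratio of consecutive Euler coefficients at most
  a constant times |q|^n, so that Euler's series converges for every x.\<close>

lemma norm_one_minus_qpow_ge:
  fixes q :: "'a::real_normed_field"
  assumes "norm q < 1"
  shows "norm (1 - q ^ Suc n) \<ge> 1 - norm q"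
proof -
  have "norm (1 - q ^ Suc n) \<ge> norm (1::'a) - norm (q ^ Suc n)"
    by (rule norm_triangle_ineq2)
  moreover have "norm (q ^ Suc n) \<le> norm q"
    using assms by (simp add: norm_mult norm_power mult_left_le power_le_one)
  ultimately show ?thesis by simp
qed

lemma summable_norm_euler:
  fixes q x :: "'a::{real_normed_field,banach}"
  assumes q: "norm q < 1"
  shows "summable (\<lambda>n. norm (euler_coeff q n * x ^ n))"
proof (rule summable_ratio_tendsto_less_1)
  fix n
  have pos: "norm (1 - q ^ Suc n) > 0"
    using one_minus_qpow_nonzero[OF q] by simp
  have "norm (euler_coeff q (Suc n)) * norm (1 - q ^ Suc n) = norm q ^ n * norm (euler_coeff q n)"
    using arg_cong[OF euler_coeff_Suc[OF q, of n], of norm] by (simp add: norm_mult norm_power)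
  then have "norm (euler_coeff q (Suc n)) = norm q ^ n * norm (euler_coeff q n) / norm (1 - q ^ Suc n)"
    using pos by (simp add: field_simps)
  also have "\<dots> \<le> norm q ^ n * norm (euler_coeff q n) / (1 - norm q)"
    using norm_one_minus_qpow_ge[OF q, of n] q by (intro divide_left_mono mult_pos_pos pos) auto
  finally have "norm (euler_coeff q (Suc n)) \<le> norm q ^ n / (1 - norm q) * norm (euler_coeff q n)"
    by simp
  then have "norm (euler_coeff q (Suc n)) * norm x ^ Suc n
      \<le> norm q ^ n / (1 - norm q) * norm (euler_coeff q n) * norm x ^ Suc n"
    by (rule mult_right_mono) simp
  then show "norm (norm (euler_coeff q (Suc n) * x ^ Suc n))
      \<le> (norm q ^ n * (norm x / (1 - norm q))) * norm (norm (euler_coeff q n * x ^ n))"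
    by (simp add: norm_mult norm_power algebra_simps)
next
  show "(\<lambda>n. norm q ^ n * (norm x / (1 - norm q))) \<longlonglongrightarrow> 0 * (norm x / (1 - norm q))"
    using q by (intro tendsto_intros LIMSEQ_power_zero) auto
qed simp

lemma summable_euler:
  fixes q x :: "'a::{real_normed_field,banach}"
  assumes q: "norm q < 1"
  shows "summable (\<lambda>n. euler_coeff q n * x ^ n)"
  using summable_norm_euler[OF q] by (rule summable_norm_cancel)

text \<open>Iterating \<open>f x = (1 - x) f (x q)\<close> pushes the argument to \<open>0\<close>.\<close>

lemma qpoch_inf_unique:
  fixes f :: "'a::{real_normed_field,banach} \<Rightarrow> 'a"
  assumes q: "norm q < 1" and rec: "\<And>x. f x = (1 - x) * f (x * q)" and cont: "isCont f 0"
  shows "f x = qpoch_inf x q * f 0"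
proof -
  have iter: "f x = qpoch x q n * f (x * q ^ n)" for n
  proof (induction n)
    case (Suc n)
    have "f (x * q ^ n) = (1 - x * q ^ n) * f (x * q ^ Suc n)"
      using rec[of "x * q ^ n"] by (simp add: mult_ac)
    then show ?case
      by (subst Suc.IH) (simp add: qpoch_Suc)
  qed simp
  have "(\<lambda>n. x * q ^ n) \<longlonglongrightarrow> x * 0"
    using q by (intro tendsto_intros LIMSEQ_power_zero)
  then have "(\<lambda>n. f (x * q ^ n)) \<longlonglongrightarrow> f 0"
    using isCont_tendsto_compose[OF cont] by simp
  then have "(\<lambda>n. qpoch x q n * f (x * q ^ n)) \<longlonglongrightarrow> qpoch_inf x q * f 0"
    by (intro tendsto_mult qpoch_LIMSEQ q)
  then show ?thesis
    unfolding iter[symmetric] by (simp add: LIMSEQ_const_iff)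
qed

lemma isCont_euler:
  fixes q x :: "'a::{real_normed_field,banach}"
  assumes q: "norm q < 1"
  shows "isCont (\<lambda>x. \<Sum>n. euler_coeff q n * x ^ n) x"
proof -
  \<comment> \<open>Any point of larger norm is a valid witness, since the series converges
    everywhere.\<close>
  have "norm x < norm (of_real (norm x + 1) :: 'a)"
    by (simp add: norm_of_real)
  then show ?thesis
    by (rule isCont_powser[OF summable_euler[OF q]])
qed

text \<open>The recurrence \<open>euler_coeff_Suc\<close> is the coefficient form of f x = (1 - x) f
  (x q). Solutions continuous at 0 are multiples of (x;q)_inf, and the constant coefficient 1 fixes
  the multiple.\<close>

lemma euler_qpoch_inf:
  fixes q x :: "'a::{real_normed_field,banach}"
  assumes q: "norm q < 1"
  shows "(\<lambda>n. euler_coeff q n * x ^ n) sums qpoch_inf x q"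
proof -
  let ?f = "\<lambda>x. \<Sum>n. euler_coeff q n * x ^ n"
  have "?f x = (1 - x) * ?f (x * q)" for x
  proof -
    have s: "summable (\<lambda>n. euler_coeff q n * (x * q) ^ n)" "summable (\<lambda>n. euler_coeff q n * x ^ n)"
      by (rule summable_euler[OF q])+
    have 1: "?f x - ?f (x * q) = (\<Sum>n. euler_coeff q n * (1 - q ^ n) * x ^ n)"
      using s by (subst suminf_diff) (auto simp: algebra_simps power_mult_distrib)
    have "summable (\<lambda>n. euler_coeff q n * (1 - q ^ n) * x ^ n)"
      using summable_diff[OF s(2,1)] by (simp add: algebra_simps power_mult_distrib)
    \<comment> \<open>The factor 1 - q^0 removes the term n = 0, so the index can be
      shifted.\<close>
    then have 2: "(\<Sum>n. euler_coeff q n * (1 - q ^ n) * x ^ n)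
        = (\<Sum>n. euler_coeff q (Suc n) * (1 - q ^ Suc n) * x ^ Suc n)"
      by (subst suminf_split_head) auto
    have "(\<Sum>n. euler_coeff q (Suc n) * (1 - q ^ Suc n) * x ^ Suc n)
        = (\<Sum>n. - x * (euler_coeff q n * (x * q) ^ n))"
      unfolding euler_coeff_Suc[OF q] by (simp add: power_mult_distrib algebra_simps)
    also have "\<dots> = - x * ?f (x * q)"
      by (rule suminf_mult[OF s(1)])
    finally show ?thesis
      using 1 2 by (simp add: algebra_simps)
  qed
  then have "?f x = qpoch_inf x q * ?f 0"
    by (rule qpoch_inf_unique[OF q _ isCont_euler[OF q]])
  moreover have "?f 0 = 1"
    by (subst powser_zero) (simp add: euler_coeff_def)
  ultimately show ?thesis
    using summable_euler[OF q, of x] by (simp add: sums_iff)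
qed

lemma summable_norm_inverse_euler:
  fixes q x :: "'a::{real_normed_field,banach}"
  assumes q: "norm q < 1" and x: "norm x < 1"
  shows "summable (\<lambda>n. norm (x ^ n / qpoch q q n))"
proof (rule summable_ratio_tendsto_less_1)
  fix n
  have "norm (norm (x ^ Suc n / qpoch q q (Suc n)))
      = (norm x / norm (1 - q ^ Suc n)) * norm (norm (x ^ n / qpoch q q n))"
    by (simp add: qpoch_Suc norm_divide norm_mult)
  then show "norm (norm (x ^ Suc n / qpoch q q (Suc n)))
      \<le> (norm x / norm (1 - q ^ Suc n)) * norm (norm (x ^ n / qpoch q q n))"
    by simp
next
  have "(\<lambda>n. q ^ Suc n) \<longlonglongrightarrow> 0"
    using q by (intro LIMSEQ_Suc LIMSEQ_power_zero)
  then show "(\<lambda>n. norm x / norm (1 - q ^ Suc n)) \<longlonglongrightarrow> norm x / norm (1 - 0 :: 'a)"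
    by (intro tendsto_intros) auto
qed (use x in simp)

text \<open>For the reciprocal series, f (y q) = (1 - y) f y is available only inside the unit disc,
  so \<open>qpoch_inf_unique\<close> does not apply and the iteration towards 0 is repeated along x
  q^n. The product form also shows that (x;q)_inf does not vanish there.\<close>

lemma euler_inverse_qpoch_inf:
  fixes q x :: "'a::{real_normed_field,banach}"
  assumes q: "norm q < 1" and x: "norm x < 1"
  shows "(\<Sum>n. x ^ n / qpoch q q n) * qpoch_inf x q = 1"
proof -
  let ?f = "\<lambda>x. \<Sum>n. x ^ n / qpoch q q n"
  have sm: "summable (\<lambda>n. y ^ n / qpoch q q n)" if "norm y < 1" for y
    using summable_norm_inverse_euler[OF q that] by (rule summable_norm_cancel)
  have small: "norm (x * q ^ n) < 1" for n
    using x q mult_le_one[of "norm x" "norm q ^ n"] power_le_one[of "norm q" n]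
    by (smt (verit) mult_left_le norm_ge_zero norm_mult norm_power)
  have rec: "?f (y * q) = (1 - y) * ?f y" if y: "norm y < 1" for y
  proof -
    have yq: "norm (y * q) < 1"
      using y q mult_left_le[of "norm q" "norm y"] by (simp add: norm_mult)
    have 1: "?f y - ?f (y * q) = (\<Sum>n. y ^ n * (1 - q ^ n) / qpoch q q n)"
      using sm[OF y] sm[OF yq]
      by (subst suminf_diff) (auto simp: algebra_simps diff_divide_distrib power_mult_distrib)
    have "summable (\<lambda>n. y ^ n * (1 - q ^ n) / qpoch q q n)"
      using summable_diff[OF sm[OF y] sm[OF yq]]
      by (simp add: algebra_simps diff_divide_distrib power_mult_distrib)
    then have "(\<Sum>n. y ^ n * (1 - q ^ n) / qpoch q q n)
        = (\<Sum>n. y ^ Suc n * (1 - q ^ Suc n) / qpoch q q (Suc n))"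
      by (subst suminf_split_head) auto
    also have "\<dots> = (\<Sum>n. y * (y ^ n / qpoch q q n))"
      using one_minus_qpow_nonzero[OF q] by (intro suminf_cong) (simp add: qpoch_Suc)
    also have "\<dots> = y * ?f y"
      by (rule suminf_mult[OF sm[OF y]])
    finally show ?thesis
      using 1 by (simp add: algebra_simps)
  qed
  have iter: "?f (x * q ^ n) = ?f x * qpoch x q n" for n
  proof (induction n)
    case (Suc n)
    have "?f (x * q ^ Suc n) = (1 - x * q ^ n) * ?f (x * q ^ n)"
      using rec[OF small[of n]] by (simp add: mult_ac)
    then show ?case
      unfolding Suc.IH by (simp add: qpoch_Suc mult_ac)
  qed simp
  have cont: "isCont ?f 0"
  proof -
    \<comment> \<open>Continuity at 0 follows from convergence at a single nonzero point; 1/2 lies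
      in the disc.\<close>
    have *: "isCont (\<lambda>x. \<Sum>n. (1 / qpoch q q n) * x ^ n) 0"
      by (rule isCont_powser[of _ "of_real (1/2)"])
        (use sm[of "of_real (1/2)"] in \<open>simp_all add: norm_of_real\<close>)
    show ?thesis using * by simp
  qed
  have "(\<lambda>n. x * q ^ n) \<longlonglongrightarrow> x * 0"
    using q by (intro tendsto_intros LIMSEQ_power_zero)
  then have lim: "(\<lambda>n. ?f (x * q ^ n)) \<longlonglongrightarrow> ?f 0"
    using isCont_tendsto_compose[OF cont] by simp
  have "?f 0 = 1"
    using powser_zero[of "\<lambda>n. 1 / qpoch q q n"] by simp
  moreover have "(\<lambda>n. ?f (x * q ^ n)) \<longlonglongrightarrow> ?f x * qpoch_inf x q"
    unfolding iter by (intro tendsto_intros qpoch_LIMSEQ q)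
  from LIMSEQ_unique[OF this lim] have "?f x * qpoch_inf x q = ?f 0" .
  ultimately show ?thesis by simp
qed

lemma qpoch_inf_nonzero:
  fixes q x :: "'a::{real_normed_field,banach}"
  assumes "norm q < 1" and "norm x < 1"
  shows "qpoch_inf x q \<noteq> 0"
  using euler_inverse_qpoch_inf[OF assms] by auto

lemma continuous_on_qpoch_inf [continuous_intros]:
  fixes f :: "'b::topological_space \<Rightarrow> 'a::{real_normed_field,banach}"
  assumes "norm q < 1" and "continuous_on A f"
  shows "continuous_on A (\<lambda>x. qpoch_inf (f x) q)"
proof -
  have "continuous_on UNIV (\<lambda>x. \<Sum>n. euler_coeff q n * x ^ n)"
    using isCont_euler[OF assms(1)] by (simp add: continuous_on_eq_continuous_at)
  then have "continuous_on UNIV (\<lambda>x. qpoch_inf x q)"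
    using euler_qpoch_inf[OF assms(1)] by (simp add: sums_iff)
  then show ?thesis
    using assms(2) continuous_on_compose2 by blast
qed

section \<open>Gaussian binomials and the finite q-binomial theorem\<close>

definition gauss_binom :: "'a::real_normed_field \<Rightarrow> nat \<Rightarrow> nat \<Rightarrow> 'a" where
  "gauss_binom q n k = qpoch q q n / (qpoch q q k * qpoch q q (n - k))"

text \<open>For k > n truncated subtraction gives \<open>gauss_binom q n k\<close> the value (q;q)_n
  / (q;q)_k instead of 0, so this q-Pascal rule is restricted to k < n.\<close>

lemma gauss_binom_Suc_Suc:
  fixes q :: "'a::real_normed_field"
  assumes q: "norm q < 1" and "k < n"
  shows "gauss_binom q (Suc n) (Suc k) = gauss_binom q n (Suc k) + q ^ (n - k) * gauss_binom q n k"
proof -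
  obtain d where n: "n = k + Suc d"
    using \<open>k < n\<close> by (metis add_Suc_right less_imp_Suc_add)
  have nz: "qpoch q q k \<noteq> 0" "qpoch q q d \<noteq> 0" "1 - q ^ Suc k \<noteq> 0" "1 - q ^ Suc d \<noteq> 0"
    using qpoch_q_nonzero[OF q] one_minus_qpow_nonzero[OF q] by blast+
  define A B x y where "A = qpoch q q k" and "B = qpoch q q d" and "x = q ^ k" and "y = q ^ d"
  have nz': "A \<noteq> 0" "B \<noteq> 0" "1 - q * x \<noteq> 0" "1 - q * y \<noteq> 0"
    using nz by (simp_all add: A_def B_def x_def y_def)
  have "gauss_binom q n (Suc k) + q ^ (n - k) * gauss_binom q n k
      = qpoch q q n * (1 / (A * (1 - q * x) * B) + q * y / (A * (B * (1 - q * y))))"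
    by (simp add: gauss_binom_def n qpoch_Suc A_def B_def x_def y_def add_divide_distrib ring_distribs)
  also have "1 / (A * (1 - q * x) * B) + q * y / (A * (B * (1 - q * y)))
      = (1 - q * q * x * y) / (A * (1 - q * x) * (B * (1 - q * y)))"
    using nz' by (simp add: divide_simps) algebra
  also have "qpoch q q n * ((1 - q * q * x * y) / (A * (1 - q * x) * (B * (1 - q * y))))
      = gauss_binom q (Suc n) (Suc k)"
    by (simp add: gauss_binom_def n qpoch_Suc A_def B_def x_def y_def power_add mult_ac)
  finally show ?thesis ..
qed

lemma gauss_binom_0 [simp]:
  fixes q :: "'a::real_normed_field"
  assumes "norm q < 1"
  shows "gauss_binom q n 0 = 1" "gauss_binom q n n = 1"
  using qpoch_q_nonzero[OF assms, of n] by (simp_all add: gauss_binom_def)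

text \<open>The new factor 1 - y q^n acts on the coefficients as the q-Pascal rule does, because
  q^(n-k) q^k = q^n. The lowest and the highest term lie outside that rule and are treated
  separately.\<close>

lemma finite_q_binomial:
  fixes q y :: "'a::real_normed_field"
  assumes q: "norm q < 1"
  shows "qpoch y q n = (\<Sum>k\<le>n. (-1) ^ k * q ^ (k choose 2) * gauss_binom q n k * y ^ k)"
proof (induction n)
  case 0
  then show ?case using q by (simp add: gauss_binom_def numeral_2_eq_2)
next
  case (Suc n)
  define t where "t n k = (-1) ^ k * q ^ (k choose 2) * gauss_binom q n k * y ^ k" for n k
  have step: "t (Suc n) (Suc k) = t n (Suc k) - t n k * y * q ^ n" if "k < n" for k
  proof -
    have "q ^ (n - k) * q ^ k = q ^ n"
      using that by (simp flip: power_add)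
    then show ?thesis
      unfolding t_def gauss_binom_Suc_Suc[OF q that] choose_two_Suc power_add
      by (simp add: algebra_simps)
  qed
  have top: "t (Suc n) (Suc n) = - t n n * y * q ^ n"
    using q by (simp add: t_def choose_two_Suc power_add)
  have bot: "t (Suc n) 0 = t n 0"
    using q by (simp add: t_def)
  have "(\<Sum>k\<le>Suc n. t (Suc n) k) = t (Suc n) 0 + (\<Sum>k<n. t (Suc n) (Suc k)) + t (Suc n) (Suc n)"
    by (simp only: lessThan_Suc_atMost[symmetric] sum.lessThan_Suc[of _ "Suc n"] sum.lessThan_Suc_shift[of _ n])
  also have "\<dots> = t n 0 + (\<Sum>k<n. t n (Suc k)) - (\<Sum>k<n. t n k) * y * q ^ n - t n n * y * q ^ n"
    using step by (simp add: top bot sum_subtractf sum_distrib_right)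
  also have "t n 0 + (\<Sum>k<n. t n (Suc k)) = (\<Sum>k\<le>n. t n k)"
    by (simp only: lessThan_Suc_atMost[symmetric] sum.lessThan_Suc_shift[of _ n])
  also have "(\<Sum>k\<le>n. t n k) - (\<Sum>k<n. t n k) * y * q ^ n - t n n * y * q ^ n
      = (\<Sum>k\<le>n. t n k) * (1 - y * q ^ n)"
    by (simp add: algebra_simps flip: lessThan_Suc_atMost)
  finally show ?case
    using Suc.IH by (simp add: t_def qpoch_Suc)
qed

section \<open>The Fourier coefficients of the theta weight\<close>

lemma sums_integral_Weierstrass:
  fixes f :: "nat \<Rightarrow> real \<Rightarrow> real"
  assumes cont: "\<And>n. continuous_on {a..b} (f n)"
    and bound: "\<And>n x. x \<in> {a..b} \<Longrightarrow> norm (f n x) \<le> M n" and M: "summable M"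
  shows "(\<lambda>n. integral {a..b} (f n)) sums integral {a..b} (\<lambda>x. \<Sum>n. f n x)"
proof -
  have u: "uniform_limit {a..b} (\<lambda>n x. \<Sum>i<n. f i x) (\<lambda>x. \<Sum>i. f i x) sequentially"
    using bound M by (intro Weierstrass_m_test) auto
  have "((\<lambda>n. integral {a..b} (\<lambda>x. \<Sum>i<n. f i x)) \<longlongrightarrow> integral {a..b} (\<lambda>x. \<Sum>n. f n x)) sequentially"
  proof -
    have "continuous_on {a..b} (\<lambda>x. \<Sum>i<n. f i x)" for n
      by (intro continuous_intros cont)
    from uniform_limit_integral[OF u this]
    obtain I J where I: "\<And>n. ((\<lambda>x. \<Sum>i<n. f i x) has_integral I n) {a..b}"
        and J: "((\<lambda>x. \<Sum>i. f i x) has_integral J) {a..b}" "(I \<longlongrightarrow> J) sequentially"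
      by auto
    show ?thesis
      using J(2) unfolding integral_unique[OF I] integral_unique[OF J(1)] .
  qed
  moreover have "integral {a..b} (\<lambda>x. \<Sum>i<n. f i x) = (\<Sum>i<n. integral {a..b} (f i))" for n
    by (intro integral_sum) (auto intro: integrable_continuous_real cont)
  ultimately show ?thesis
    by (simp add: sums_def)
qed

lemma integral_cos_int:
  "integral {0..pi} (\<lambda>x. cos (of_int k * x)) = (if k = 0 then pi else 0)"
proof (cases "k = 0")
  case False
  have "((\<lambda>x. cos (of_int k * x)) has_integral sin (of_int k * pi) / of_int k - sin (of_int k * 0) / of_int k) {0..pi}"
    using False
    by (intro fundamental_theorem_of_calculus)
      (auto intro!: derivative_eq_intros simp flip: has_real_derivative_iff_has_vector_derivative)
  moreover have "sin (of_int k * pi) = 0"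
    by (metis mult.commute sin_npi_int)
  ultimately show ?thesis
    using False by (simp add: integral_unique)
qed simp

text \<open>Product-to-sum formula; for j = k = 0 both indicators are 1, which gives the value
  pi.\<close>

lemma integral_cos_cos_int:
  "integral {0..pi} (\<lambda>x. cos (of_int j * x) * cos (of_int k * x))
     = pi / 2 * (of_bool (j = k) + of_bool (j = - k))"
proof -
  have "cos (of_int j * x) * cos (of_int k * x)
      = cos (of_int (j - k) * x) / 2 + cos (of_int (j + k) * x) / 2" for x :: real
    unfolding cos_times_cos by (simp add: algebra_simps add_divide_distrib)
  then have "integral {0..pi} (\<lambda>x. cos (of_int j * x) * cos (of_int k * x))
      = integral {0..pi} (\<lambda>x. cos (of_int (j - k) * x) / 2) + integral {0..pi} (\<lambda>x. cos (of_int (j + k) * x) / 2)"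
    by (simp only:) (intro integral_add integrable_continuous_real continuous_intros, auto)
  also have "\<dots> = integral {0..pi} (\<lambda>x. cos (of_int (j - k) * x)) / 2 + integral {0..pi} (\<lambda>x. cos (of_int (j + k) * x)) / 2"
    by simp
  also have "\<dots> = pi / 2 * (of_bool (j = k) + of_bool (j = - k))"
    unfolding integral_cos_int by auto
  finally show ?thesis .
qed

locale q_base =
  fixes q :: real
  assumes q_pos: "0 < q" and q_less_1: "q < 1"
begin

abbreviation qc :: complex where "qc \<equiv> of_real q"

lemma norm_q: "norm q < 1" and norm_qc: "norm qc < 1"
  using q_pos q_less_1 by (simp_all add: norm_of_real)

lemma q_nz [simp]: "q \<noteq> 0"
  using q_pos by simp

lemma qpoch_q_pos: "qpoch q q n > 0"
proof -
  have "q * q ^ j < 1" for j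
    using q_pos q_less_1 power_Suc_less_one[of q j] by simp
  then show ?thesis
    by (auto simp: qpoch_def intro!: prod_pos)
qed

lemma qpoch_inf_q_pos: "qpoch_inf q q > 0"
proof -
  have "qpoch_inf q q \<ge> 0"
    using qpoch_LIMSEQ[OF norm_q, of q] qpoch_q_pos
    by (intro LIMSEQ_le_const) (auto simp: less_imp_le)
  then show ?thesis
    using qpoch_inf_nonzero[OF norm_q norm_q] by simp
qed

section \<open>A finite form of the Jacobi triple product\<close>

definition theta_fin :: "nat \<Rightarrow> complex \<Rightarrow> complex" where
  "theta_fin M u = qpoch u qc (Suc M) * qpoch (qc / u) qc M"

lemma cnj_qpoch: "cnj (qpoch x qc n) = qpoch (cnj x) qc n"
  by (simp add: qpoch_def)

text \<open>For |u| = 1 conjugation sends (uq;q)_M to (q/u;q)_M. The lengths M + 1 and M in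
  \<open>theta_fin\<close> leave one unpaired factor, so it equals (1 - u) R with R >= 0, and |1 -
  u|^2 = 2 Re (1 - u).\<close>

lemma norm_qpoch_eq_Re_theta_fin:
  assumes "norm u = 1"
  shows "(norm (qpoch u qc (Suc M)))\<^sup>2 = 2 * Re (theta_fin M u)"
proof -
  have u: "u \<noteq> 0"
    using assms by auto
  have "u * cnj u = 1"
    using assms complex_norm_square[of u] by simp
  then have cu: "cnj u = 1 / u"
    using u by (simp add: field_simps)
  define R where "R = (norm (qpoch (u * qc) qc M))\<^sup>2"
  have "theta_fin M u = (1 - u) * (qpoch (u * qc) qc M * cnj (qpoch (u * qc) qc M))"
    by (simp add: theta_fin_def qpoch_Suc_shift cnj_qpoch cu)
  then have "theta_fin M u = (1 - u) * of_real R"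
    by (simp only: R_def complex_norm_square)
  then have 1: "2 * Re (theta_fin M u) = (2 - 2 * Re u) * R"
    by simp
  have "(norm (1 - u))\<^sup>2 = 2 - 2 * Re u"
    using assms unfolding cmod_power2 by (simp add: power2_eq_square algebra_simps cmod_def)
  then show ?thesis
    unfolding 1 by (simp add: qpoch_Suc_shift norm_mult power_mult_distrib R_def)
qed

text \<open>Pulling -q^j/u out of each factor 1 - q^j/u turns (q/u;q)_M into the missing first
  factors of (u q^(-M);q)_(2M+1), to which the finite q-binomial theorem applies.\<close>

lemma theta_fin_expand:
  assumes u: "u \<noteq> 0"
  shows "theta_fin M u = (\<Sum>k\<le>2 * M + 1. (-1) ^ (M + k) *
    of_real (q ^ ((Suc M choose 2) + (k choose 2)) / q ^ (M * k) * gauss_binom q (2 * M + 1) k) * (u ^ k / u ^ M))"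
proof -
  define y where "y = u / qc ^ M"
  have qc0: "qc \<noteq> 0" by simp
  have *: "qpoch (qc / u) qc M * (- u) ^ M = qpoch y qc M * qc ^ (Suc M choose 2)"
    unfolding y_def
  proof (induction M)
    case (Suc M)
    have s1: "qpoch (qc / u) qc (Suc M) * (- u) ^ Suc M
        = (qpoch (qc / u) qc M * (- u) ^ M) * (qc ^ Suc M - u)"
      using u by (simp add: qpoch_Suc field_simps)
    have s2: "qpoch (u / qc ^ Suc M) qc (Suc M) = (1 - u / qc ^ Suc M) * qpoch (u / qc ^ M) qc M"
      unfolding qpoch_Suc_shift by simp
    show ?case
      unfolding s1 s2 Suc.IH choose_two_Suc[of "Suc M"] power_add using qc0
      by (simp add: field_simps)
  qed (simp add: choose_two_Suc)
  have "qpoch y qc (M + n) = qpoch y qc M * qpoch u qc n" for n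
    by (induction n) (simp_all add: qpoch_Suc y_def power_add mult_ac)
  from this[of "Suc M"] have "qpoch y qc (2 * M + 1) = qpoch y qc M * qpoch u qc (Suc M)"
    by (simp add: mult_2)
  then have "theta_fin M u * (- u) ^ M = qc ^ (Suc M choose 2) * qpoch y qc (2 * M + 1)"
    using * by (simp add: theta_fin_def mult_ac)
  then have "theta_fin M u * ((- u) ^ M * ((-1) ^ M / u ^ M))
      = qc ^ (Suc M choose 2) * qpoch y qc (2 * M + 1) * ((-1) ^ M / u ^ M)"
    by (metis mult.assoc)
  also have "(- u) ^ M * ((-1) ^ M / u ^ M) = 1"
    using u by (cases "even M") auto
  finally have "theta_fin M u = (-1) ^ M * qc ^ (Suc M choose 2) / u ^ M * qpoch y qc (2 * M + 1)"
    by (simp add: mult_ac)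
  also have "\<dots> = (\<Sum>k\<le>2 * M + 1. (-1) ^ M * qc ^ (Suc M choose 2) / u ^ M *
      ((-1) ^ k * qc ^ (k choose 2) * gauss_binom qc (2 * M + 1) k * y ^ k))"
    unfolding finite_q_binomial[OF norm_qc] by (rule sum_distrib_left)
  also have "\<dots> = (\<Sum>k\<le>2 * M + 1. (-1) ^ (M + k) *
    of_real (q ^ ((Suc M choose 2) + (k choose 2)) / q ^ (M * k) * gauss_binom q (2 * M + 1) k) * (u ^ k / u ^ M))"
    by (intro sum.cong)
      (simp_all add: y_def power_add power_divide gauss_binom_def qpoch_of_real mult_ac flip: power_mult)
  finally show ?thesis .
qed

text \<open>With r = k - M this is (-1)^r q^(r(r-1)/2), the coefficient of u^r in Jacobi's theta
  series; the quotient keeps all exponents natural for negative r too.\<close>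

definition theta_sign :: "nat \<Rightarrow> nat \<Rightarrow> real" where
  "theta_sign M k = (-1) ^ (M + k) * (q ^ ((Suc M choose 2) + (k choose 2)) / q ^ (M * k))"

definition theta_coeff :: "nat \<Rightarrow> nat \<Rightarrow> real" where
  "theta_coeff M k = theta_sign M k * gauss_binom q (2 * M + 1) k"

lemma norm_qpoch_fourier:
  "(norm (qpoch (exp (2 * \<i> * of_real t)) qc (Suc M)))\<^sup>2
     = 2 * (\<Sum>k\<le>2 * M + 1. theta_coeff M k * cos (of_int (2 * (int k - int M)) * t))"
proof -
  define u where "u = exp (2 * \<i> * of_real t)"
  have u: "norm u = 1" "u \<noteq> 0"
    by (simp_all add: u_def norm_exp_eq_Re)
  have "u ^ k / u ^ M = exp (of_int (2 * (int k - int M)) * of_real t * \<i>)" for k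
    unfolding u_def by (simp add: exp_diff algebra_simps flip: exp_of_nat_mult)
  then have "u ^ k / u ^ M = cis (of_int (2 * (int k - int M)) * t)" for k
    by (simp add: cis_conv_exp mult_ac)
  then have "theta_fin M u = (\<Sum>k\<le>2 * M + 1. of_real (theta_coeff M k) * cis (of_int (2 * (int k - int M)) * t))"
    unfolding theta_fin_expand[OF u(2)] theta_coeff_def theta_sign_def
    by (intro sum.cong) (simp_all add: mult_ac)
  then have "Re (theta_fin M u) = (\<Sum>k\<le>2 * M + 1. theta_coeff M k * cos (of_int (2 * (int k - int M)) * t))"
    by simp
  then show ?thesis
    using norm_qpoch_eq_Re_theta_fin[OF u(1), of M] by (simp add: u_def)
qed

lemma integral_norm_qpoch_cos:
  "integral {0..pi} (\<lambda>t. (norm (qpoch (exp (2 * \<i> * of_real t)) qc (Suc M)))\<^sup>2 * cos (of_int r * t))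
   = pi * (\<Sum>k\<le>2 * M + 1. theta_coeff M k * (of_bool (2 * (int k - int M) = r) + of_bool (2 * (int k - int M) = - r)))"
proof -
  have "integral {0..pi} (\<lambda>t. (norm (qpoch (exp (2 * \<i> * of_real t)) qc (Suc M)))\<^sup>2 * cos (of_int r * t))
      = integral {0..pi} (\<lambda>t. \<Sum>k\<le>2 * M + 1. 2 * theta_coeff M k *
          (cos (of_int (2 * (int k - int M)) * t) * cos (of_int r * t)))"
    unfolding norm_qpoch_fourier by (simp only: sum_distrib_left sum_distrib_right mult_ac)
  also have "\<dots> = (\<Sum>k\<le>2 * M + 1. 2 * theta_coeff M k *
      integral {0..pi} (\<lambda>t. cos (of_int (2 * (int k - int M)) * t) * cos (of_int r * t)))"
    by (subst integral_sum)
      (auto intro!: integrable_continuous_real continuous_intros)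
  also have "\<dots> = (\<Sum>k\<le>2 * M + 1. pi * (theta_coeff M k * (of_bool (2 * (int k - int M) = r) + of_bool (2 * (int k - int M) = - r))))"
    unfolding integral_cos_cos_int by (simp add: mult_ac)
  finally show ?thesis
    by (simp add: sum_distrib_left)
qed

lemma theta_sign_shift:
  shows "theta_sign M (M + m) = (-1) ^ m * q ^ (m choose 2)"
    and "m \<le> M \<Longrightarrow> theta_sign M (M - m) = (-1) ^ m * q ^ (Suc m choose 2)"
proof -
  have e: "q ^ a / q ^ b = q ^ c" if "a = b + c" for a b c
    using that by (simp add: power_add)
  have 1: "(Suc M choose 2) + ((M + m) choose 2) = M * (M + m) + (m choose 2)" for M m :: nat
  proof (induction M)
    case (Suc M)
    then show ?case
      unfolding add_Suc choose_two_Suc[of "Suc M"] choose_two_Suc[of "M + m"] by simp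
  qed (simp add: choose_two_Suc)
  show "theta_sign M (M + m) = (-1) ^ m * q ^ (m choose 2)"
    unfolding theta_sign_def e[OF 1] by (simp add: minus_one_power_iff)
  show "theta_sign M (M - m) = (-1) ^ m * q ^ (Suc m choose 2)" if "m \<le> M"
  proof -
    define d where "d = M - m"
    have M: "M = d + m"
      using that by (simp add: d_def)
    have 2: "(Suc (d + m) choose 2) + (d choose 2) = (d + m) * d + (Suc m choose 2)"
    proof (induction d)
      case (Suc d)
      then show ?case
        unfolding add_Suc choose_two_Suc[of "Suc (d + m)"] choose_two_Suc[of d] by (simp add: algebra_simps)
    qed simp
    show ?thesis
      unfolding theta_sign_def M diff_add_inverse2 e[OF 2] by (simp add: minus_one_power_iff)
  qed
qed

section \<open>Passage to the infinite theta weight\<close>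

lemma gauss_binom_LIMSEQ:
  assumes "filterlim f at_top sequentially" "filterlim h at_top sequentially" "\<And>n. f n \<le> g n" "\<And>n. h n = g n - f n"
  shows "(\<lambda>n. gauss_binom q (g n) (f n)) \<longlonglongrightarrow> 1 / qpoch_inf q q"
proof -
  have lim: "(\<lambda>n. qpoch q q (k n)) \<longlonglongrightarrow> qpoch_inf q q" if "filterlim k at_top sequentially" for k :: "nat \<Rightarrow> nat"
    using filterlim_compose[OF qpoch_LIMSEQ[OF norm_q] that] .
  have "filterlim g at_top sequentially"
    by (rule filterlim_at_top_mono[OF assms(1)]) (simp add: assms(3))
  then have "(\<lambda>n. qpoch q q (g n) / (qpoch q q (f n) * qpoch q q (h n))) \<longlonglongrightarrow> qpoch_inf q q / (qpoch_inf q q * qpoch_inf q q)"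
    using qpoch_inf_q_pos by (intro tendsto_intros lim assms(1,2)) auto
  then show ?thesis
    using qpoch_inf_q_pos by (simp add: gauss_binom_def assms(4))
qed

definition gw :: "real \<Rightarrow> real" where
  "gw t = (norm (qpoch_inf (exp (2 * \<i> * of_real t)) qc))\<^sup>2"

lemma continuous_on_gw [continuous_intros]: "continuous_on A gw"
  unfolding gw_def by (intro continuous_intros norm_qc)

text \<open>1 + q^j <= exp (q^j) bounds the product by the exponential of a geometric series,
  uniformly in n and x. This supplies the dominating constant for the limit below.\<close>

lemma norm_qpoch_le:
  assumes "norm x \<le> 1"
  shows "norm (qpoch x qc n) \<le> exp (1 / (1 - q))"
proof -
  have "norm (qpoch x qc n) = (\<Prod>j<n. norm (1 - x * qc ^ j))"
    by (simp add: qpoch_def prod_norm)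
  also have "\<dots> \<le> (\<Prod>j<n. exp (q ^ j))"
  proof (intro prod_mono conjI)
    fix j
    have "norm (1 - x * qc ^ j) \<le> norm (1::complex) + norm (x * qc ^ j)"
      by (rule norm_triangle_ineq4)
    moreover have "norm (x * qc ^ j) \<le> 1 * q ^ j"
      unfolding norm_mult using assms q_pos by (intro mult_mono) (auto simp: norm_power norm_of_real)
    ultimately show "norm (1 - x * qc ^ j) \<le> exp (q ^ j)"
      using exp_ge_add_one_self[of "q ^ j"] unfolding norm_one by linarith
  qed auto
  also have "\<dots> = exp (\<Sum>j<n. q ^ j)"
    by (simp add: exp_sum)
  also have "\<dots> \<le> exp (1 / (1 - q))"
    using sum_le_suminf[of "\<lambda>j. q ^ j" "{..<n}"] q_pos q_less_1 norm_q
    by (simp add: summable_geometric suminf_geometric)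
  finally show ?thesis .
qed

lemma integral_gw_cos_LIMSEQ:
  "(\<lambda>M. integral {0..pi} (\<lambda>t. (norm (qpoch (exp (2 * \<i> * of_real t)) qc (Suc M)))\<^sup>2 * cos (of_int r * t)))
    \<longlonglongrightarrow> integral {0..pi} (\<lambda>t. gw t * cos (of_int r * t))"
proof (rule dominated_convergence)
  show "(\<lambda>t. (norm (qpoch (exp (2 * \<i> * of_real t)) qc (Suc M)))\<^sup>2 * cos (of_int r * t)) integrable_on {0..pi}" for M
    unfolding qpoch_def by (intro integrable_continuous_real continuous_intros)
  show "(\<lambda>t. (exp (1 / (1 - q)))\<^sup>2) integrable_on {0..pi}"
    by (intro integrable_continuous_real continuous_intros)
  show "norm ((norm (qpoch (exp (2 * \<i> * of_real t)) qc (Suc M)))\<^sup>2 * cos (of_int r * t)) \<le> (exp (1 / (1 - q)))\<^sup>2"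
    for M t
  proof -
    have "norm (exp (2 * \<i> * of_real t) :: complex) \<le> 1"
      by (simp add: norm_exp_eq_Re)
    then have "(norm (qpoch (exp (2 * \<i> * of_real t)) qc (Suc M)))\<^sup>2 * \<bar>cos (of_int r * t)\<bar> \<le> (exp (1 / (1 - q)))\<^sup>2 * 1"
      by (intro mult_mono power_mono norm_qpoch_le) auto
    then show ?thesis by (simp add: abs_mult)
  qed
  show "(\<lambda>M. (norm (qpoch (exp (2 * \<i> * of_real t)) qc (Suc M)))\<^sup>2 * cos (of_int r * t))
      \<longlonglongrightarrow> gw t * cos (of_int r * t)" for t
    unfolding gw_def by (intro tendsto_intros LIMSEQ_Suc qpoch_LIMSEQ norm_qc)
qed

text \<open>The weight depends on e^(2it) only, so before the limit only the even frequencies 2(k -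
  M) occur.\<close>

lemma integral_gw_cos_odd:
  assumes "odd r"
  shows "integral {0..pi} (\<lambda>t. gw t * cos (of_int r * t)) = 0"
proof -
  have "(of_bool (2 * i = r) + of_bool (2 * i = - r) :: real) = 0" for i
  proof -
    have "2 * i \<noteq> r" "2 * i \<noteq> - r"
      using assms by (auto dest: arg_cong[of _ _ even])
    then show ?thesis by simp
  qed
  then show ?thesis
    using integral_gw_cos_LIMSEQ[of r] unfolding integral_norm_qpoch_cos
    by (simp only: mult_zero_right sum.neutral_const LIMSEQ_const_iff)
qed

text \<open>Before the limit only k = M + m and k = M - m survive, and both Gaussian binomials tend
  to 1 / (q;q)_inf. For m = 0 the two indices coincide and their term counts twice.\<close>

lemma integral_gw_cos_even:
  "integral {0..pi} (\<lambda>t. gw t * cos (of_int (2 * int m) * t))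
    = pi * (-1) ^ m * (q ^ (m choose 2) + q ^ (Suc m choose 2)) / qpoch_inf q q"
proof -
  have ev: "integral {0..pi} (\<lambda>t. (norm (qpoch (exp (2 * \<i> * of_real t)) qc (Suc M)))\<^sup>2 * cos (of_int (2 * int m) * t))
      = pi * (theta_coeff M (M + m) + theta_coeff M (M - m))" if "m \<le> M" for M
  proof -
    have "(\<Sum>k\<le>2 * M + 1. theta_coeff M k * (of_bool (2 * (int k - int M) = 2 * int m) + of_bool (2 * (int k - int M) = - (2 * int m))))
      = (\<Sum>k\<le>2 * M + 1. (if k = M + m then theta_coeff M k else 0) + (if k = M - m then theta_coeff M k else 0))"
      using that by (intro sum.cong) (auto simp: of_bool_def)
    also have "\<dots> = theta_coeff M (M + m) + theta_coeff M (M - m)"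
      using that by (simp add: sum.distrib)
    finally show ?thesis
      unfolding integral_norm_qpoch_cos by simp
  qed
  \<comment> \<open>Starting the sequence at m keeps the index M - m free of truncation.\<close>
  have "(\<lambda>M. pi * (theta_coeff (M + m) (M + m + m) + theta_coeff (M + m) (M + m - m)))
      \<longlonglongrightarrow> integral {0..pi} (\<lambda>t. gw t * cos (of_int (2 * int m) * t))"
    using LIMSEQ_ignore_initial_segment[OF integral_gw_cos_LIMSEQ[of "2 * int m"], of m]
    by (simp add: ev del: of_int_mult)
  moreover have "(\<lambda>M. pi * (theta_coeff (M + m) (M + m + m) + theta_coeff (M + m) (M + m - m)))
      \<longlonglongrightarrow> pi * ((-1) ^ m * q ^ (m choose 2) * (1 / qpoch_inf q q) + (-1) ^ m * q ^ (Suc m choose 2) * (1 / qpoch_inf q q))"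
  proof -
    have lin: "filterlim (\<lambda>n::nat. n + c) at_top sequentially" for c
      by (rule filterlim_add_const_nat_at_top)
    have eq: "theta_coeff (M + m) (M + m - m) = (-1) ^ m * q ^ (Suc m choose 2) * gauss_binom q (2 * (M + m) + 1) (M + m - m)" for M
      using theta_sign_shift(2)[of m "M + m"] by (simp add: theta_coeff_def)
    have lim1: "(\<lambda>M. gauss_binom q (2 * (M + m) + 1) (M + m + m)) \<longlonglongrightarrow> 1 / qpoch_inf q q"
      using lin[of "m + m"] lin[of 1] by (intro gauss_binom_LIMSEQ[where h = "\<lambda>M. M + 1"]) (auto simp: add.assoc)
    have lim2: "(\<lambda>M. gauss_binom q (2 * (M + m) + 1) (M + m - m)) \<longlonglongrightarrow> 1 / qpoch_inf q q"
      using lin[of 0] lin[of "2 * m + 1"]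
      by (intro gauss_binom_LIMSEQ[where h = "\<lambda>M. M + (2 * m + 1)"]) (auto simp: add.assoc)
    show ?thesis
      unfolding theta_coeff_def[of _ "_ + m + m"] theta_sign_shift(1) eq by (intro tendsto_intros lim1 lim2)
  qed
  ultimately have "integral {0..pi} (\<lambda>t. gw t * cos (of_int (2 * int m) * t))
      = pi * ((-1) ^ m * q ^ (m choose 2) * (1 / qpoch_inf q q) + (-1) ^ m * q ^ (Suc m choose 2) * (1 / qpoch_inf q q))"
    by (rule LIMSEQ_unique)
  then show ?thesis
    by (simp add: algebra_simps add_divide_distrib)
qed

end

section \<open>The weighted functional\<close>

text \<open>The coefficient of b^n in |sum_k a_k (b e^(it))^k|^2; the sines cancel under i -> n -
  i.\<close>

definition self_conv :: "(nat \<Rightarrow> real) \<Rightarrow> nat \<Rightarrow> real \<Rightarrow> real" where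
  "self_conv a n t = (\<Sum>i\<le>n. a i * a (n - i) * cos (of_int (2 * int i - int n) * t))"

lemma self_conv_bound: "\<bar>self_conv a n t\<bar> \<le> (\<Sum>i\<le>n. \<bar>a i\<bar> * \<bar>a (n - i)\<bar>)"
  unfolding self_conv_def
  by (rule order_trans[OF sum_abs]) (auto intro!: sum_mono mult_left_le simp: abs_mult)

lemma summable_self_conv_bound:
  fixes a :: "nat \<Rightarrow> real"
  assumes "summable (\<lambda>k. norm (a k * b ^ k))"
  shows "summable (\<lambda>n. (\<Sum>i\<le>n. \<bar>a i\<bar> * \<bar>a (n - i)\<bar>) * \<bar>b\<bar> ^ n)"
proof -
  have "(\<Sum>i\<le>n. norm (a i * b ^ i) * norm (a (n - i) * b ^ (n - i)))
      = (\<Sum>i\<le>n. \<bar>a i\<bar> * \<bar>a (n - i)\<bar>) * \<bar>b\<bar> ^ n" for n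
    unfolding sum_distrib_right
  proof (intro sum.cong)
    fix i assume "i \<in> {..n}"
    then have "\<bar>b\<bar> ^ n = \<bar>b\<bar> ^ i * \<bar>b\<bar> ^ (n - i)"
      by (simp flip: power_add)
    then show "norm (a i * b ^ i) * norm (a (n - i) * b ^ (n - i)) = \<bar>a i\<bar> * \<bar>a (n - i)\<bar> * \<bar>b\<bar> ^ n"
      by (simp add: abs_mult power_abs)
  qed simp
  then show ?thesis
    using summable_Cauchy_product[of "\<lambda>k. norm (a k * b ^ k)" "\<lambda>k. norm (a k * b ^ k)"] assms
    by simp
qed

text \<open>Cauchy product of the series with its conjugate, followed by taking real parts.\<close>

lemma self_conv_sums:
  fixes a :: "nat \<Rightarrow> real"
  assumes "summable (\<lambda>k. norm (a k * b ^ k))"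
  shows "(\<lambda>n. self_conv a n t * b ^ n) sums
    (norm (\<Sum>k. of_real (a k) * (of_real b * exp (\<i> * of_real t)) ^ k))\<^sup>2"
proof -
  define f where "f k = of_real (a k) * (of_real b * exp (\<i> * of_real t)) ^ k" for k
  have f: "f k = of_real (a k * b ^ k) * cis (of_nat k * t)" for k
    by (simp add: f_def power_mult_distrib cis_conv_exp exp_of_nat_mult[symmetric] mult_ac)
  have nf: "summable (\<lambda>k. norm (f k))" "summable (\<lambda>k. norm (cnj (f k)))"
    using assms by (simp_all add: f norm_mult norm_power abs_mult power_abs)
  have "(\<lambda>n. \<Sum>i\<le>n. f i * cnj (f (n - i))) sums ((\<Sum>k. f k) * (\<Sum>k. cnj (f k)))"
    by (rule Cauchy_product_sums[OF nf])
  also have "(\<Sum>k. cnj (f k)) = cnj (\<Sum>k. f k)"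
    using sums_cnj[of f "\<Sum>k. f k"] summable_norm_cancel[OF nf(1)] by (simp add: sums_iff summable_sums)
  also have "(\<Sum>k. f k) * cnj (\<Sum>k. f k) = of_real ((norm (\<Sum>k. f k))\<^sup>2)"
    by (simp only: complex_norm_square)
  finally have "(\<lambda>n. Re (\<Sum>i\<le>n. f i * cnj (f (n - i)))) sums (norm (\<Sum>k. f k))\<^sup>2"
    using sums_Re by fastforce
  moreover have "Re (\<Sum>i\<le>n. f i * cnj (f (n - i))) = self_conv a n t * b ^ n" for n
    unfolding self_conv_def sum_distrib_right Re_sum
  proof (intro sum.cong)
    fix i assume i: "i \<in> {..n}"
    then have "b ^ n = b ^ i * b ^ (n - i)"
      by (simp flip: power_add)
    moreover have "f i * cnj (f (n - i)) = of_real (a i * b ^ i * (a (n - i) * b ^ (n - i)))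
        * cis (of_int (2 * int i - int n) * t)"
      using i by (simp add: f cis_cnj cis_mult of_nat_diff algebra_simps)
    ultimately show "Re (f i * cnj (f (n - i))) = a i * a (n - i) * cos (of_int (2 * int i - int n) * t) * b ^ n"
      by simp
  qed simp
  ultimately show ?thesis
    by (simp add: f_def)
qed

lemma continuous_on_self_conv [continuous_intros]: "continuous_on A (self_conv a n)"
  unfolding self_conv_def by (intro continuous_intros)

context q_base
begin

section \<open>The normalised functional of the theta weight\<close>

definition L :: "(real \<Rightarrow> real) \<Rightarrow> real" where
  "L f = qpoch_inf q q / (2 * pi) * integral {0..pi} (\<lambda>t. f t * gw t)"

lemma L_integrable:
  assumes "continuous_on {0..pi} f"
  shows "(\<lambda>t. f t * gw t) integrable_on {0..pi}"
  by (intro integrable_continuous_real continuous_intros assms)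

lemma L_add:
  assumes "continuous_on {0..pi} f" "continuous_on {0..pi} g"
  shows "L (\<lambda>t. f t + g t) = L f + L g"
  using integral_add[OF L_integrable[OF assms(1)] L_integrable[OF assms(2)]]
  by (simp add: L_def algebra_simps)

lemma L_cmult: "L (\<lambda>t. k * f t) = k * L f"
  by (simp add: L_def mult.assoc)

lemma L_sum:
  assumes "finite I" "\<And>i. i \<in> I \<Longrightarrow> continuous_on {0..pi} (f i)"
  shows "L (\<lambda>t. \<Sum>i\<in>I. f i t) = (\<Sum>i\<in>I. L (f i))"
  using integral_sum[OF assms(1) L_integrable, OF assms(2)]
  by (simp add: L_def sum_distrib_left sum_distrib_right)

lemma L_cong:
  assumes "\<And>t. f t = g t"
  shows "L f = L g"
  using assms by presburger

text \<open>The weight is continuous, hence bounded on [0, pi], so a summable bound for the f n is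
  enough for termwise integration.\<close>

lemma L_sums:
  assumes "\<And>n. continuous_on {0..pi} (f n)" and "\<And>n t. norm (f n t) \<le> M n" and "summable M"
    and "\<And>t. (\<lambda>n. f n t) sums s t"
  shows "(\<lambda>n. L (f n)) sums L s"
proof -
  have "compact (gw ` {0..pi})"
    by (intro compact_continuous_image continuous_intros compact_Icc)
  then have "bounded (gw ` {0..pi})"
    by (rule compact_imp_bounded)
  then obtain B where B: "\<And>t. t \<in> {0..pi} \<Longrightarrow> norm (gw t) \<le> B"
    unfolding bounded_iff by blast
  have "norm (f n t * gw t) \<le> M n * B" if "t \<in> {0..pi}" for n t
    unfolding norm_mult using assms(2)[of n t] B[OF that]
    by (intro mult_mono) (auto intro: order_trans[OF norm_ge_zero])
  then have "(\<lambda>n. integral {0..pi} (\<lambda>t. f n t * gw t)) sums integral {0..pi} (\<lambda>t. \<Sum>n. f n t * gw t)"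
    using assms(1,3)
    by (intro sums_integral_Weierstrass[where M = "\<lambda>n. M n * B"]) (auto intro!: continuous_intros summable_mult2)
  moreover have "(\<Sum>n. f n t * gw t) = s t * gw t" for t
    using sums_mult2[OF assms(4)] by (simp add: sums_iff)
  ultimately show ?thesis
    unfolding L_def by (intro sums_mult) simp
qed

lemma L_cos_odd: "odd r \<Longrightarrow> L (\<lambda>t. cos (of_int r * t)) = 0"
  using integral_gw_cos_odd[of r] by (simp add: L_def mult.commute)

lemma L_cos_even: "L (\<lambda>t. cos (of_int (2 * int m) * t)) = (-1) ^ m * (q ^ (m choose 2) + q ^ (Suc m choose 2)) / 2"
  using integral_gw_cos_even[of m] qpoch_inf_q_pos unfolding L_def by (simp add: mult.commute)

text \<open>Since cosine is even, i < M reduces to the nonnegative frequency 2(M - i); the two terms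
  of \<open>L_cos_even\<close> are the values of \<open>theta_sign\<close> at i and at its mirror
  image.\<close>

lemma L_cos_theta_sign:
  assumes "i \<le> 2 * M"
  shows "L (\<lambda>t. cos (of_int (2 * int i - int (2 * M)) * t)) = (theta_sign M i + theta_sign M (2 * M - i)) / 2"
proof (cases "M \<le> i")
  case True
  define m where "m = i - M"
  have i: "i = M + m" "2 * M - i = M - m" "m \<le> M" "2 * int i - int (2 * M) = 2 * int m"
    using True assms by (auto simp: m_def)
  show ?thesis
    using i(3) unfolding i(4) L_cos_even i(2) unfolding i(1)
    by (simp add: theta_sign_shift algebra_simps)
next
  case False
  define m where "m = M - i"
  have i: "i = M - m" "2 * M - i = M + m" "m \<le> M" "2 * int i - int (2 * M) = - (2 * int m)"
    using False assms by (auto simp: m_def)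
  have "L (\<lambda>t. cos (of_int (2 * int i - int (2 * M)) * t)) = L (\<lambda>t. cos (of_int (2 * int m) * t))"
    unfolding i(4) by simp
  then show ?thesis
    using i(3) unfolding L_cos_even i(2) unfolding i(1)
    by (simp add: theta_sign_shift algebra_simps)
qed

text \<open>By the finite q-binomial theorem the sum is a multiple of (q^(-M);q)_(2M), whose factor
  j = M is zero; M > 0 ensures M < 2M.\<close>

lemma sum_theta_sign:
  assumes "M > 0"
  shows "(\<Sum>i\<le>2 * M. theta_sign M i / (qpoch q q i * qpoch q q (2 * M - i))) = 0"
proof -
  have "(\<Sum>i\<le>2 * M. theta_sign M i / (qpoch q q i * qpoch q q (2 * M - i)))
      = (\<Sum>i\<le>2 * M. (-1) ^ M * q ^ (Suc M choose 2) / qpoch q q (2 * M) *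
          ((-1) ^ i * q ^ (i choose 2) * gauss_binom q (2 * M) i * (1 / q ^ M) ^ i))"
    using qpoch_q_pos[of "2 * M"]
    by (intro sum.cong) (auto simp: theta_sign_def gauss_binom_def power_add power_one_over mult_ac simp flip: power_mult)
  also have "\<dots> = (-1) ^ M * q ^ (Suc M choose 2) / qpoch q q (2 * M) * qpoch (1 / q ^ M) q (2 * M)"
    unfolding finite_q_binomial[OF norm_q] by (simp add: sum_distrib_left)
  also have "qpoch (1 / q ^ M) q (2 * M) = 0"
    using assms unfolding qpoch_def by (intro prod_zero bexI[of _ M]) auto
  finally show ?thesis by simp
qed

text \<open>This is H_n(cos t | q) / (q;q)_n with H_n the continuous q-Hermite (Rogers)
  polynomial.\<close>

definition rogers :: "nat \<Rightarrow> real \<Rightarrow> real" where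
  "rogers = self_conv (\<lambda>k. 1 / qpoch q q k)"

text \<open>For odd n all frequencies are odd. For n = 2M the cosine moments give two copies,
  mirrored by i -> 2M - i, of half the sum in \<open>sum_theta_sign\<close>.\<close>

lemma L_rogers: "L (rogers n) = of_bool (n = 0)"
proof -
  have L1: "L (rogers n) = (\<Sum>i\<le>n. 1 / qpoch q q i * (1 / qpoch q q (n - i)) * L (\<lambda>t. cos (of_int (2 * int i - int n) * t)))" for n
    unfolding rogers_def self_conv_def L_cmult[symmetric]
    by (rule L_sum) (simp, intro continuous_intros)
  show ?thesis
  proof (cases "even n")
    case False
    then have "L (\<lambda>t. cos (of_int (2 * int i - int n) * t)) = 0" for i
      by (intro L_cos_odd) simp
    moreover have "n \<noteq> 0"
      using False by (simp add: odd_pos)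
    ultimately show ?thesis
      unfolding L1 by simp
  next
    case True
    then obtain M where n: "n = 2 * M"
      by blast
    let ?S = "\<Sum>i\<le>2 * M. theta_sign M i / (qpoch q q i * qpoch q q (2 * M - i))"
    let ?T = "\<Sum>i\<le>2 * M. theta_sign M (2 * M - i) / (qpoch q q i * qpoch q q (2 * M - i))"
    have "L (rogers n) = (\<Sum>i\<le>2 * M. 1 / qpoch q q i * (1 / qpoch q q (2 * M - i)) * ((theta_sign M i + theta_sign M (2 * M - i)) / 2))"
      unfolding L1 n by (intro sum.cong refl) (simp only: L_cos_theta_sign atMost_iff)
    also have "\<dots> = (?S + ?T) / 2"
      by (simp add: sum.distrib[symmetric] sum_divide_distrib add_divide_distrib algebra_simps)
    also have "?T = ?S"
      by (rule sum.reindex_bij_witness[of _ "\<lambda>i. 2 * M - i" "\<lambda>i. 2 * M - i"]) (auto simp: mult.commute)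
    finally have LS: "L (rogers n) = ?S"
      by simp
    show ?thesis
    proof (cases "M = 0")
      case True
      then show ?thesis
        using LS n by (simp add: theta_sign_def choose_two_Suc)
    next
      case False
      then show ?thesis
        using LS n sum_theta_sign[of M] by simp
    qed
  qed
qed

section \<open>The weight factors (c e^(it), c e^(-it); q)_inf\<close>

definition E :: "real \<Rightarrow> real \<Rightarrow> real" where
  "E c t = (norm (qpoch_inf (of_real c * exp (\<i> * of_real t)) qc))\<^sup>2"

lemma continuous_on_E [continuous_intros]: "continuous_on A (E c)"
  unfolding E_def by (intro continuous_intros norm_qc)

lemma E_rec: "E c t = (1 + c\<^sup>2 - 2 * c * cos t) * E (c * q) t"
proof -
  let ?z = "of_real c * exp (\<i> * of_real t)"
  have 1: "(norm (1 - ?z))\<^sup>2 = 1 + c\<^sup>2 - 2 * c * cos t"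
  proof -
    have "?z = Complex (c * cos t) (c * sin t)"
      by (simp add: complex_eq_iff Re_exp Im_exp)
    moreover have "(1 - c * cos t)\<^sup>2 + (c * sin t)\<^sup>2 = 1 + c\<^sup>2 * ((sin t)\<^sup>2 + (cos t)\<^sup>2) - 2 * c * cos t"
      by (simp only: power2_eq_square) algebra
    ultimately show ?thesis
      by (simp add: cmod_power2)
  qed
  have 2: "qpoch_inf ?z qc = (1 - ?z) * qpoch_inf (of_real (c * q) * exp (\<i> * of_real t)) qc"
    by (subst qpoch_inf_rec[OF norm_qc]) (simp add: mult_ac)
  show ?thesis
    unfolding E_def 2 norm_mult power_mult_distrib 1 ..
qed

lemma E_pos:
  assumes "\<bar>b\<bar> < 1"
  shows "E b t > 0"
  using qpoch_inf_nonzero[OF norm_qc, of "of_real b * exp (\<i> * of_real t)"] assms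
  by (simp add: E_def norm_mult norm_exp_eq_Re)

text \<open>The generating function of the q-Hermite polynomials: the squared modulus of Euler's
  reciprocal series at b e^(it).\<close>

lemma inverse_E_sums:
  assumes "\<bar>b\<bar> < 1"
  shows "(\<lambda>n. rogers n t * b ^ n) sums (1 / E b t)"
proof -
  let ?z = "of_real b * exp (\<i> * of_real t)"
  have z: "norm ?z < 1"
    using assms by (simp add: norm_mult norm_exp_eq_Re)
  have "(\<lambda>n. rogers n t * b ^ n) sums (norm (\<Sum>k. of_real (1 / qpoch q q k) * ?z ^ k))\<^sup>2"
    unfolding rogers_def using summable_norm_inverse_euler[OF norm_q, of b] assms
    by (intro self_conv_sums) simp
  also have "(\<Sum>k. of_real (1 / qpoch q q k) * ?z ^ k) = (\<Sum>k. ?z ^ k / qpoch qc qc k)"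
    by (simp add: qpoch_of_real divide_inverse mult_ac)
  also have "(norm (\<Sum>k. ?z ^ k / qpoch qc qc k))\<^sup>2 = 1 / E b t"
  proof -
    have "(norm (\<Sum>k. ?z ^ k / qpoch qc qc k))\<^sup>2 * E b t = 1"
      unfolding E_def power_mult_distrib[symmetric] norm_mult[symmetric]
        euler_inverse_qpoch_inf[OF norm_qc z] by simp
    then show ?thesis
      using E_pos[OF assms, of t] by (simp add: field_simps)
  qed
  finally show ?thesis .
qed

text \<open>Termwise integration of the generating function leaves only n = 0. The value is the mass
  at c = 0.\<close>

lemma L_inverse_E:
  assumes "\<bar>b\<bar> < 1"
  shows "L (\<lambda>t. 1 / E b t) = 1"
proof -
  let ?a = "\<lambda>k. 1 / qpoch q q k"
  have sm: "summable (\<lambda>k. norm (?a k * b ^ k))"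
    using summable_norm_inverse_euler[OF norm_q, of b] assms by simp
  have "(\<lambda>n. L (\<lambda>t. b ^ n * rogers n t)) sums L (\<lambda>t. 1 / E b t)"
  proof (rule L_sums[OF _ _ summable_self_conv_bound[OF sm]])
    show "norm (b ^ n * rogers n t) \<le> (\<Sum>i\<le>n. \<bar>?a i\<bar> * \<bar>?a (n - i)\<bar>) * \<bar>b\<bar> ^ n" for n t
      using mult_right_mono[OF self_conv_bound[of ?a n t], of "\<bar>b\<bar> ^ n"]
      by (simp add: rogers_def abs_mult power_abs mult.commute)
    show "(\<lambda>n. b ^ n * rogers n t) sums (1 / E b t)" for t
      using inverse_E_sums[OF assms] by (simp add: mult.commute)
  qed (auto intro!: continuous_intros simp: rogers_def)
  then have "(\<lambda>n. if n = 0 then 1 else 0) sums L (\<lambda>t. 1 / E b t)"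
    unfolding L_cmult L_rogers by (rule sums_cong[THEN iffD1, rotated]) auto
  then show ?thesis
    using sums_If_finite_set[of "{0::nat}" "\<lambda>_. 1 :: real"] sums_unique2 by fastforce
qed

lemma E_sums: "(\<lambda>n. self_conv (euler_coeff q) n t * c ^ n) sums E c t"
proof -
  let ?z = "of_real c * exp (\<i> * of_real t)"
  have "(\<Sum>k. of_real (euler_coeff q k) * ?z ^ k) = qpoch_inf ?z qc"
    using euler_qpoch_inf[OF norm_qc, of ?z] by (simp add: sums_iff euler_coeff_def qpoch_of_real)
  then show ?thesis
    using self_conv_sums[OF summable_norm_euler[OF norm_q], where t = t and b = c] by (simp add: E_def)
qed

section \<open>The functional with the parameters b and c\<close>

definition LL :: "real \<Rightarrow> real \<Rightarrow> (real \<Rightarrow> real) \<Rightarrow> real" where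
  "LL b c f = L (\<lambda>t. f (cos t) * (E c t / E b t))"

lemma continuous_on_weight:
  assumes "\<bar>b\<bar> < 1" and "continuous_on UNIV f"
  shows "continuous_on A (\<lambda>t. f (cos t) * (E c t / E b t))"
proof -
  have "continuous_on A (\<lambda>t. f (cos t))"
    by (rule continuous_on_compose2[OF assms(2)]) (auto intro: continuous_intros)
  then show ?thesis
    using E_pos[OF assms(1)] by (intro continuous_intros) (auto simp: less_le)
qed

lemma LL_add:
  assumes "\<bar>b\<bar> < 1" "continuous_on UNIV f" "continuous_on UNIV g"
  shows "LL b c (\<lambda>x. f x + g x) = LL b c f + LL b c g"
  using L_add[OF continuous_on_weight[OF assms(1,2), where c = c] continuous_on_weight[OF assms(1,3), where c = c]]
  by (simp only: LL_def distrib_right)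

lemma LL_cmult: "LL b c (\<lambda>x. k * f x) = k * LL b c f"
  unfolding LL_def mult.assoc L_cmult ..

text \<open>\<open>E b\<close> stands in the denominator, so the quadratic cancels its first factor
  and moves b to b q. In \<open>LL_shift_c\<close> the factor is in the numerator, so the quadratic
  moves c q back to c.\<close>

lemma LL_shift_b: "LL b c (\<lambda>x. (1 + b\<^sup>2 - 2 * b * x) * f x) = LL (b * q) c f" if "\<bar>b\<bar> < 1"
proof -
  have "(1 + b\<^sup>2 - 2 * b * cos t) * f (cos t) * (E c t / E b t) = f (cos t) * (E c t / E (b * q) t)" for t
  proof -
    define e where "e = 1 + b\<^sup>2 - 2 * b * cos t"
    have "e \<noteq> 0"
      using E_pos[OF that, of t] E_rec[of b t] by (auto simp: e_def)
    then show ?thesis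
      unfolding E_rec[of b] e_def[symmetric] by simp
  qed
  then show ?thesis
    by (simp add: LL_def)
qed

lemma LL_shift_c: "LL b (c * q) (\<lambda>x. (1 + c\<^sup>2 - 2 * c * x) * f x) = LL b c f"
  unfolding LL_def by (rule L_cong) (simp add: E_rec[of c])

lemma abs_bq: "\<bar>b\<bar> < 1 \<Longrightarrow> \<bar>b * q\<bar> < 1"
  using q_pos q_less_1 mult_left_le[of q "\<bar>b\<bar>"] by (simp add: abs_mult)

lemma LL_one_contiguous:
  assumes b: "\<bar>b\<bar> < 1"
  shows "b * LL b c (\<lambda>_. 1) = c * LL (b * q) (c * q) (\<lambda>_. 1) + (b - c) * (1 - b * c) * LL b (c * q) (\<lambda>_. 1)"
proof -
  have "b * LL b c (\<lambda>_. 1) = LL b (c * q) (\<lambda>x. b * ((1 + c\<^sup>2 - 2 * c * x) * 1))"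
    unfolding LL_cmult LL_shift_c ..
  \<comment> \<open>The linear dependence b (1 + c^2 - 2cx) = c (1 + b^2 - 2bx) + (b - c)(1 -
    bc).\<close>
  also have "\<dots> = LL b (c * q) (\<lambda>x. c * ((1 + b\<^sup>2 - 2 * b * x) * 1) + (b - c) * (1 - b * c) * 1)"
    by (rule arg_cong[of _ _ "LL b (c * q)"]) (auto simp: fun_eq_iff power2_eq_square algebra_simps)
  also have "\<dots> = c * LL (b * q) (c * q) (\<lambda>_. 1) + (b - c) * (1 - b * c) * LL b (c * q) (\<lambda>_. 1)"
    by (subst LL_add[OF b]) (simp_all only: LL_cmult LL_shift_b[OF b], auto intro!: continuous_intros)
  finally show ?thesis .
qed

text \<open>Exhibits the mass as a power series in c with coefficients depending on b alone, the
  form required by \<open>contiguous_powser_zero\<close>.\<close>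

lemma LL_one_sums:
  assumes b: "\<bar>b\<bar> < 1"
  shows "(\<lambda>n. L (\<lambda>t. self_conv (euler_coeff q) n t / E b t) * c ^ n) sums LL b c (\<lambda>_. 1)"
proof -
  let ?M = "\<lambda>n. (\<Sum>i\<le>n. \<bar>euler_coeff q i\<bar> * \<bar>euler_coeff q (n - i)\<bar>) * \<bar>c\<bar> ^ n"
  \<comment> \<open>A bound uniform in t, obtained from the termwise majorant of the q-Hermite
    generating function.\<close>
  have "\<exists>B. \<forall>t. 1 / E b t \<le> B"
  proof -
    let ?S = "\<Sum>n. (\<Sum>i\<le>n. \<bar>1 / qpoch q q i\<bar> * \<bar>1 / qpoch q q (n - i)\<bar>) * \<bar>b\<bar> ^ n"
    have sm: "summable (\<lambda>n. (\<Sum>i\<le>n. \<bar>1 / qpoch q q i\<bar> * \<bar>1 / qpoch q q (n - i)\<bar>) * \<bar>b\<bar> ^ n)"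
      using summable_norm_inverse_euler[OF norm_q, of b] b by (intro summable_self_conv_bound) simp
    have "1 / E b t \<le> ?S" for t
    proof (rule sums_le[OF _ inverse_E_sums[OF b] summable_sums[OF sm]])
      fix n
      have "rogers n t * b ^ n \<le> \<bar>rogers n t\<bar> * \<bar>b\<bar> ^ n"
        by (metis abs_ge_self abs_mult power_abs)
      also have "\<dots> \<le> (\<Sum>i\<le>n. \<bar>1 / qpoch q q i\<bar> * \<bar>1 / qpoch q q (n - i)\<bar>) * \<bar>b\<bar> ^ n"
        unfolding rogers_def by (intro mult_right_mono self_conv_bound) simp
      finally show "rogers n t * b ^ n \<le> (\<Sum>i\<le>n. \<bar>1 / qpoch q q i\<bar> * \<bar>1 / qpoch q q (n - i)\<bar>) * \<bar>b\<bar> ^ n" .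
    qed
    then show ?thesis by blast
  qed
  then obtain B where B: "\<And>t. 1 / E b t \<le> B"
    by blast
  have "(\<lambda>n. L (\<lambda>t. c ^ n * (self_conv (euler_coeff q) n t / E b t))) sums L (\<lambda>t. 1 * (E c t / E b t))"
  proof (rule L_sums)
    show "summable (\<lambda>n. ?M n * B)"
      by (intro summable_mult2 summable_self_conv_bound summable_norm_euler norm_q)
    show "norm (c ^ n * (self_conv (euler_coeff q) n t / E b t)) \<le> ?M n * B" for n t
    proof -
      have "norm (c ^ n * (self_conv (euler_coeff q) n t / E b t))
          = (\<bar>self_conv (euler_coeff q) n t\<bar> * \<bar>c\<bar> ^ n) * (1 / E b t)"
        using E_pos[OF b, of t] by (simp add: abs_mult power_abs)
      also have "\<dots> \<le> ?M n * B"
        using E_pos[OF b, of t] B[of t]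
        by (intro mult_mono self_conv_bound mult_right_mono) (auto intro!: mult_nonneg_nonneg sum_nonneg)
      finally show ?thesis .
    qed
    show "(\<lambda>n. c ^ n * (self_conv (euler_coeff q) n t / E b t)) sums (1 * (E c t / E b t))" for t
      using sums_divide[OF E_sums[of t c], of "E b t"] by (simp add: mult.commute)
    show "continuous_on {0..pi} (\<lambda>t. c ^ n * (self_conv (euler_coeff q) n t / E b t))" for n
      using E_pos[OF b] by (intro continuous_intros) (auto simp: less_le)
  qed
  then show ?thesis
    unfolding LL_def L_cmult by (simp only: mult.commute)
qed

lemma self_conv_euler_0: "L (\<lambda>t. self_conv (euler_coeff q) 0 t / E b t) = 1" if "\<bar>b\<bar> < 1"
  using L_inverse_E[OF that] by (simp add: self_conv_def euler_coeff_def)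

end

section \<open>Contiguous relations\<close>

text \<open>At n = 0 the factor 1 - q^0 vanishes, so the truncated index n - 1 is harmless.\<close>

lemma asc_mult_x:
  "2 * x * al_salam_chihara n x a b q = al_salam_chihara (Suc n) x a b q
     + (a + b) * q ^ n * al_salam_chihara n x a b q
     + (1 - q ^ n) * (1 - a * b * q ^ (n - 1)) * al_salam_chihara (n - 1) x a b q"
  by (cases n) (auto simp: algebra_simps)

text \<open>Strong induction on the degree: after the two lower cases are inserted into the
  recurrence for b, one use of the recurrence for b q closes the gap. At k = 0 there is only one
  lower case, and explicit values replace the other.\<close>

lemma asc_Suc_shift_b:
  "al_salam_chihara (Suc n) x a b q
     = al_salam_chihara (Suc n) x a (b * q) q - b * (1 - q ^ Suc n) * al_salam_chihara n x a (b * q) q"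
proof (induction n rule: less_induct)
  case (less n)
  show ?case
  proof (cases n)
    case 0
    then show ?thesis by (simp add: algebra_simps)
  next
    case n: (Suc k)
    define S R where "S j = al_salam_chihara j x a b q" and "R j = al_salam_chihara j x a (b * q) q" for j
    define u where "u = q ^ k"
    have S: "S (Suc (Suc k)) = (2 * x - (a + b) * (q * u)) * S (Suc k) - (1 - q * u) * (1 - a * b * u) * S k"
      and R: "R (Suc (Suc k)) = (2 * x - (a + b * q) * (q * u)) * R (Suc k) - (1 - q * u) * (1 - a * (b * q) * u) * R k"
      by (simp_all add: S_def R_def u_def)
    have 1: "S (Suc k) = R (Suc k) - b * (1 - q * u) * R k"
      using less[of k] n by (simp add: S_def R_def u_def)
    have "S (Suc (Suc k)) = R (Suc (Suc k)) - b * (1 - q * (q * u)) * R (Suc k)"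
    proof (cases k)
      case 0
      then have "u = 1" "S k = 1" "R k = 1" "R (Suc k) = 2 * x - (a + b * q)"
        by (simp_all add: S_def R_def u_def)
      then show ?thesis
        unfolding S R 1 by algebra
    next
      case k: (Suc j)
      define w where "w = q ^ j"
      have u: "u = q * w"
        by (simp add: u_def w_def k)
      have 2: "S k = R k - b * (1 - q * w) * R j"
        using less[of j] n k by (simp add: S_def R_def w_def)
      have 3: "R (Suc k) = (2 * x - (a + b * q) * (q * w)) * R k - (1 - q * w) * (1 - a * (b * q) * w) * R j"
        unfolding k by (simp add: R_def w_def)
      show ?thesis
        unfolding S R 1 2 u using 3 by algebra
    qed
    then show ?thesis
      by (simp add: S_def R_def u_def n)
  qed
qed

text \<open>Rewriting both polynomials on the right by \<open>asc_Suc_shift_b\<close> leaves only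
  parameter b q, and the three-term recurrence finishes. The quadratic is the one of
  \<open>LL_shift_b\<close>.\<close>

lemma asc_christoffel:
  "(1 + b\<^sup>2 - 2 * b * x) * al_salam_chihara n x a (b * q) q
     = (1 - a * b * q ^ n) * al_salam_chihara n x a b q - b * al_salam_chihara (Suc n) x a b q"
proof (cases n)
  case 0
  then show ?thesis by (simp add: power2_eq_square algebra_simps)
next
  case (Suc k)
  define R where "R j = al_salam_chihara j x a (b * q) q" for j
  define u where "u = q ^ k"
  have R: "R (Suc (Suc k)) = (2 * x - (a + b * q) * (q * u)) * R (Suc k) - (1 - q * u) * (1 - a * (b * q) * u) * R k"
    by (simp add: R_def u_def)
  have "(1 + b\<^sup>2 - 2 * b * x) * R (Suc k) = (1 - a * b * (q * u)) * (R (Suc k) - b * (1 - q * u) * R k)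
      - b * (R (Suc (Suc k)) - b * (1 - q * (q * u)) * R (Suc k))"
    unfolding R by algebra
  then show ?thesis
    unfolding Suc asc_Suc_shift_b[of _ x a b q] by (simp add: R_def u_def)
qed

lemma continuous_on_asc [continuous_intros]:
  "continuous_on A (\<lambda>x. al_salam_chihara n x a b q)"
proof (induction n rule: less_induct)
  case (less n)
  consider "n = 0" | "n = Suc 0" | k where "n = Suc (Suc k)"
    by (metis not0_implies_Suc)
  then show ?case
  proof cases
    case 3
    then show ?thesis
      using less[of k] less[of "Suc k"] by (auto intro!: continuous_intros)
  qed (auto intro!: continuous_intros)
qed

text \<open>Dividing by \<open>c ^ n\<close> and letting \<open>c\<close> tend to \<open>0\<close>, the leading coefficient satisfies
  \<open>d n b = q ^ n * d n b\<close>.\<close>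

lemma (in q_base) contiguous_powser_zero:
  fixes d :: "nat \<Rightarrow> real \<Rightarrow> real" and D :: "real \<Rightarrow> real \<Rightarrow> real"
  assumes sums: "\<And>b c. 0 < b \<Longrightarrow> b < 1 \<Longrightarrow> (\<lambda>n. d n b * c ^ n) sums D b c"
    and rel: "\<And>b c. 0 < b \<Longrightarrow> b < 1 \<Longrightarrow> c \<noteq> 0 \<Longrightarrow>
      b * D b c = c * D (b * q) (c * q) + (b - c) * (1 - b * c) * D b (c * q)"
    and d0: "\<And>b. 0 < b \<Longrightarrow> b < 1 \<Longrightarrow> d 0 b = 0"
    and b: "0 < b" "b < 1"
  shows "d n b = 0"
  using b
proof (induction n arbitrary: b rule: less_induct)
  case (less n)
  show ?case
  proof (cases "n = 0")
    case True
    then show ?thesis using d0 less.prems by simp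
  next
    case False
    have bq: "0 < b * q" "b * q < 1"
      using less.prems q_pos abs_bq[of b] by auto
    \<comment> \<open>By the induction hypothesis the coefficients below n vanish, so for c nonzero
      this is again a power series in c, with constant term \<open>d n b\<close>.\<close>
    define h where "h b c = D b c / c ^ n" for b c
    have hs: "(\<lambda>m. d (m + n) b * c ^ m) sums h b c" if "0 < b" "b < 1" "c \<noteq> 0" for b c
    proof -
      have "(\<lambda>m. d (m + n) b * c ^ (m + n)) sums D b c"
        using sums[OF that(1,2), of c] less.IH[OF _ that(1,2)]
        by (subst sums_zero_iff_shift) auto
      from sums_divide[OF this, of "c ^ n"] show ?thesis
        using that(3) by (simp add: h_def power_add)
    qed
    have lim: "((\<lambda>c. h b c) \<longlongrightarrow> d n b) (at 0)"
      using powser_limit_0_strong[of 1 "\<lambda>m. d (m + n) b" "h b"] hs[OF less.prems] by simp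
    have limq: "((\<lambda>c. h b (c * q)) \<longlongrightarrow> d n b) (at 0)" if "0 < b" "b < 1" for b
    proof -
      have "(\<lambda>m. d (m + n) b * q ^ m * c ^ m) sums h b (c * q)" if "c \<noteq> 0" for c
        using hs[OF \<open>0 < b\<close> \<open>b < 1\<close>, of "c * q"] that by (simp add: power_mult_distrib mult_ac)
      then show ?thesis
        using powser_limit_0_strong[of 1 "\<lambda>m. d (m + n) b * q ^ m" "\<lambda>c. h b (c * q)"] by simp
    qed
    have "((\<lambda>c. c * q ^ n * h (b * q) (c * q) + (b - c) * (1 - b * c) * q ^ n * h b (c * q))
        \<longlongrightarrow> 0 * q ^ n * d n (b * q) + (b - 0) * (1 - b * 0) * q ^ n * d n b) (at 0)"
      by (intro tendsto_intros limq bq less.prems)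
    moreover have "eventually (\<lambda>c. c * q ^ n * h (b * q) (c * q) + (b - c) * (1 - b * c) * q ^ n * h b (c * q) = b * h b c) (at 0)"
    proof (rule eventually_at_filter[THEN iffD2, OF always_eventually], intro allI impI)
      fix c :: real assume c: "c \<noteq> 0"
      have *: "q ^ n * h b' (c * q) = D b' (c * q) / c ^ n" for b'
        using c by (simp add: h_def power_mult_distrib)
      have "c * q ^ n * h (b * q) (c * q) + (b - c) * (1 - b * c) * q ^ n * h b (c * q)
          = c * (q ^ n * h (b * q) (c * q)) + (b - c) * (1 - b * c) * (q ^ n * h b (c * q))"
        by (simp only: mult.assoc)
      also have "\<dots> = b * D b c / c ^ n"
        unfolding * rel[OF less.prems c] by (simp add: add_divide_distrib)
      finally show "c * q ^ n * h (b * q) (c * q) + (b - c) * (1 - b * c) * q ^ n * h b (c * q) = b * h b c"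
        by (simp add: h_def)
    qed
    ultimately have "((\<lambda>c. b * h b c) \<longlongrightarrow> 0 * q ^ n * d n (b * q) + (b - 0) * (1 - b * 0) * q ^ n * d n b) (at 0)"
      by (rule Lim_transform_eventually)
    moreover have "((\<lambda>c. b * h b c) \<longlongrightarrow> b * d n b) (at 0)"
      by (intro tendsto_intros lim)
    ultimately have "b * d n b = 0 * q ^ n * d n (b * q) + (b - 0) * (1 - b * 0) * q ^ n * d n b"
      using tendsto_unique trivial_limit_at by blast
    then have "b * ((1 - q ^ n) * d n b) = 0"
      by (simp add: algebra_simps)
    moreover have "q ^ n < 1"
      using False q_pos q_less_1 by (simp add: power_less_one_iff)
    ultimately show ?thesis
      using less.prems by auto
  qed
qed

context q_base
begin

section \<open>The series \<open>Phi\<close> and its contiguous relations\<close>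

definition rr_coeff :: "nat \<Rightarrow> real" where
  "rr_coeff k = q ^ (k * (k - 1)) / qpoch q q k"

lemma rr_coeff_0 [simp]: "rr_coeff 0 = 1"
  by (simp add: rr_coeff_def)

lemma rr_coeff_Suc: "rr_coeff (Suc k) * (1 - q * q ^ k) = (q ^ k)\<^sup>2 * rr_coeff k"
proof -
  have "Suc k * k = k + k + k * (k - 1)"
    by (cases k) auto
  then have "q ^ (Suc k * (Suc k - 1)) = (q ^ k)\<^sup>2 * q ^ (k * (k - 1))"
    by (simp only: diff_Suc_1 power_add power2_eq_square)
  moreover have "1 - q * q ^ k \<noteq> 0"
    using one_minus_qpow_nonzero[OF norm_q, of k] by simp
  ultimately show ?thesis
    unfolding rr_coeff_def by (simp add: qpoch_Suc)
qed

lemma summable_norm_rr_coeff: "summable (\<lambda>k. norm (rr_coeff k * z ^ k))"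
proof (rule summable_ratio_tendsto_less_1)
  fix k
  have "rr_coeff (Suc k) = (q ^ k)\<^sup>2 / (1 - q * q ^ k) * rr_coeff k"
    using rr_coeff_Suc[of k] one_minus_qpow_nonzero[OF norm_q, of k] by (simp add: field_simps)
  then show "norm (norm (rr_coeff (Suc k) * z ^ Suc k))
      \<le> \<bar>(q ^ k)\<^sup>2 / (1 - q * q ^ k) * z\<bar> * norm (norm (rr_coeff k * z ^ k))"
    by (simp add: abs_mult mult_ac)
next
  have "(\<lambda>k. q ^ k) \<longlonglongrightarrow> 0"
    using norm_q by (rule LIMSEQ_power_zero)
  then show "(\<lambda>k. \<bar>(q ^ k)\<^sup>2 / (1 - q * q ^ k) * z\<bar>) \<longlonglongrightarrow> \<bar>0\<^sup>2 / (1 - q * 0) * z\<bar>"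
    by (intro tendsto_intros) (use q_pos q_less_1 in auto)
qed simp

text \<open>\<open>Phi v z\<close> is \<open>(v;q)\<^sub>\<infinity> \<^sub>0\<phi>\<^sub>1(-;v;q,z)\<close>, which stays meaningful when \<open>(v;q)\<^sub>k = 0\<close>.\<close>

definition Phi :: "real \<Rightarrow> real \<Rightarrow> real" where
  "Phi v z = (\<Sum>k. rr_coeff k * z ^ k * qpoch_inf (v * q ^ k) q)"

lemma Phi_sums: "(\<lambda>k. rr_coeff k * z ^ k * qpoch_inf (v * q ^ k) q) sums Phi v z"
proof -
  have "continuous_on UNIV (\<lambda>x. qpoch_inf x q)"
    by (intro continuous_intros norm_q)
  then have "isCont (\<lambda>x. qpoch_inf x q) 0"
    by (simp add: continuous_on_eq_continuous_at)
  moreover have "(\<lambda>k. v * q ^ k) \<longlonglongrightarrow> v * 0"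
    using norm_q by (intro tendsto_intros LIMSEQ_power_zero)
  ultimately have "(\<lambda>k. qpoch_inf (v * q ^ k) q) \<longlonglongrightarrow> qpoch_inf 0 q"
    using isCont_tendsto_compose[of 0 "\<lambda>x. qpoch_inf x q" "\<lambda>k. v * q ^ k"] by simp
  then have "Bseq (\<lambda>k. qpoch_inf (v * q ^ k) q)"
    by (intro convergent_imp_Bseq convergentI)
  then obtain B where B: "\<And>k. norm (qpoch_inf (v * q ^ k) q) \<le> B"
    by (auto simp: Bseq_def)
  have "summable (\<lambda>k. rr_coeff k * z ^ k * qpoch_inf (v * q ^ k) q)"
  proof (rule summable_comparison_test'[OF summable_mult2[OF summable_norm_rr_coeff[of z], of B]])
    show "norm (rr_coeff k * z ^ k * qpoch_inf (v * q ^ k) q) \<le> norm (rr_coeff k * z ^ k) * B" for k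
      unfolding norm_mult[of "rr_coeff k * z ^ k"] by (intro mult_left_mono B) simp
  qed
  then show ?thesis
    unfolding Phi_def by (rule summable_sums)
qed

lemma qpoch_inf_step: "qpoch_inf (v * q ^ k) q = (1 - v * q ^ k) * qpoch_inf (v * q ^ Suc k) q"
  by (subst qpoch_inf_rec[OF norm_q]) (simp add: mult_ac)

text \<open>For identities with a factor z on the right: coefficient k + 1 on the left meets
  coefficient k on the right, and the constant term on the left is zero.\<close>

lemma telescoped_sums_eq:
  fixes f g :: "nat \<Rightarrow> real"
  assumes "f sums s" "g sums t" "f 0 = 0" "\<And>k. f (Suc k) = g k"
  shows "s = t"
proof -
  have "(\<lambda>k. f (Suc k)) sums s"
    using assms(1,3) by (simp add: sums_Suc_iff)
  then show ?thesis
    using assms(2,4) sums_unique2 by simp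
qed

text \<open>At v = bc and z = c^2 this is c times the relation of
  \<open>LL_one_contiguous\<close>.\<close>

lemma Phi_shift_both:
  "v * Phi v z - v * (1 - v) * Phi (v * q) (z * q\<^sup>2) = z * (Phi (v * q\<^sup>2) (z * q\<^sup>2) - (1 - v) * Phi (v * q) (z * q\<^sup>2))"
proof (rule telescoped_sums_eq)
  let ?X = "\<lambda>w k. qpoch_inf (w * q ^ k) q"
  let ?P = "\<lambda>w y k. rr_coeff k * y ^ k * ?X w k"
  show "(\<lambda>k. v * ?P v z k - v * (1 - v) * ?P (v * q) (z * q\<^sup>2) k) sums (v * Phi v z - v * (1 - v) * Phi (v * q) (z * q\<^sup>2))"
    by (intro sums_diff sums_mult Phi_sums)
  show "(\<lambda>k. z * (?P (v * q\<^sup>2) (z * q\<^sup>2) k - (1 - v) * ?P (v * q) (z * q\<^sup>2) k))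
      sums (z * (Phi (v * q\<^sup>2) (z * q\<^sup>2) - (1 - v) * Phi (v * q) (z * q\<^sup>2)))"
    by (intro sums_diff sums_mult Phi_sums)
  show "v * ?P v z 0 - v * (1 - v) * ?P (v * q) (z * q\<^sup>2) 0 = 0"
    using qpoch_inf_step[of v 0] by simp
  fix k
  define u where "u = q ^ k"
  define X where "X = qpoch_inf (v * q ^ Suc (Suc k)) q"
  have X: "?X v (Suc k) = (1 - v * (q * u)) * X" "?X (v * q) (Suc k) = X" "?X (v * q\<^sup>2) k = X"
      "?X (v * q) k = (1 - v * (q * u)) * X"
    using qpoch_inf_step[of v "Suc k"] by (simp_all add: X_def u_def power2_eq_square mult_ac)
  have z: "(z * q\<^sup>2) ^ k = z ^ k * u\<^sup>2" "(z * q\<^sup>2) ^ Suc k = z * z ^ k * (q * u)\<^sup>2"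
    by (simp_all add: u_def power_mult_distrib power2_eq_square)
  have A: "rr_coeff (Suc k) * (1 - q * u) = u\<^sup>2 * rr_coeff k"
    unfolding u_def by (rule rr_coeff_Suc)
  have alg: "v * (R' * (z * Z) * ((1 - v * (q * u)) * X)) - v * (1 - v) * (R' * (z * Z * (q * u)\<^sup>2) * X)
      = z * (R * (Z * u\<^sup>2) * X - (1 - v) * (R * (Z * u\<^sup>2) * ((1 - v * (q * u)) * X)))"
    if "R' * (1 - q * u) = u\<^sup>2 * R" for R R' Z X u :: real
    using that by algebra
  show "v * ?P v z (Suc k) - v * (1 - v) * ?P (v * q) (z * q\<^sup>2) (Suc k)
      = z * (?P (v * q\<^sup>2) (z * q\<^sup>2) k - (1 - v) * ?P (v * q) (z * q\<^sup>2) k)"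
    unfolding X z power_Suc[of z] by (rule alg[OF A])
qed

text \<open>Trades a shift of v for a shift of z; it drives the induction on the degree in
  \<open>LL_asc\<close>.\<close>

lemma Phi_shift_v:
  "q * v * (Phi v (z * q) - Phi v z) = z * q * (Phi v (z * q) - Phi (v * q) (z * q))"
proof (rule telescoped_sums_eq)
  let ?X = "\<lambda>w k. qpoch_inf (w * q ^ k) q"
  let ?P = "\<lambda>w y k. rr_coeff k * y ^ k * ?X w k"
  show "(\<lambda>k. q * v * (?P v (z * q) k - ?P v z k)) sums (q * v * (Phi v (z * q) - Phi v z))"
    by (intro sums_diff sums_mult Phi_sums)
  show "(\<lambda>k. z * q * (?P v (z * q) k - ?P (v * q) (z * q) k)) sums (z * q * (Phi v (z * q) - Phi (v * q) (z * q)))"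
    by (intro sums_diff sums_mult Phi_sums)
  show "q * v * (?P v (z * q) 0 - ?P v z 0) = 0"
    by simp
  fix k
  define u where "u = q ^ k"
  define X where "X = qpoch_inf (v * q ^ Suc k) q"
  have X: "?X v (Suc k) = X" "?X v k = (1 - v * u) * X" "?X (v * q) k = X"
    using qpoch_inf_step[of v k] by (simp_all add: X_def u_def mult_ac)
  have z: "(z * q) ^ k = z ^ k * u" "(z * q) ^ Suc k = z * z ^ k * (q * u)"
    by (simp_all add: u_def power_mult_distrib)
  have A: "rr_coeff (Suc k) * (1 - q * u) = u\<^sup>2 * rr_coeff k"
    unfolding u_def by (rule rr_coeff_Suc)
  have alg: "q * v * (R' * (z * Z * (q * u)) * X - R' * (z * Z) * X)
      = z * q * (R * (Z * u) * ((1 - v * u) * X) - R * (Z * u) * X)"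
    if "R' * (1 - q * u) = u\<^sup>2 * R" for R R' Z X u :: real
    using that by algebra
  show "q * v * (?P v (z * q) (Suc k) - ?P v z (Suc k)) = z * q * (?P v (z * q) k - ?P (v * q) (z * q) k)"
    unfolding X z power_Suc[of z] by (rule alg[OF A])
qed

lemma Phi_q_difference:
  assumes "s\<^sup>2 = q"
  shows "Phi (q * s) z - (1 + s) * Phi (q * s) (z * q) + s * Phi (q * s) (z * q\<^sup>2) = z * Phi (q * s) (z * q\<^sup>2)"
proof (rule telescoped_sums_eq)
  let ?X = "\<lambda>k. qpoch_inf (q * s * q ^ k) q"
  let ?P = "\<lambda>y k. rr_coeff k * y ^ k * ?X k"
  show "(\<lambda>k. ?P z k - (1 + s) * ?P (z * q) k + s * ?P (z * q\<^sup>2) k)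
      sums (Phi (q * s) z - (1 + s) * Phi (q * s) (z * q) + s * Phi (q * s) (z * q\<^sup>2))"
    by (intro sums_diff sums_add sums_mult Phi_sums)
  show "(\<lambda>k. z * ?P (z * q\<^sup>2) k) sums (z * Phi (q * s) (z * q\<^sup>2))"
    by (intro sums_mult Phi_sums)
  show "?P z 0 - (1 + s) * ?P (z * q) 0 + s * ?P (z * q\<^sup>2) 0 = 0"
    by (simp add: algebra_simps)
  fix k
  define u where "u = q ^ k"
  define X where "X = qpoch_inf (q * s * q ^ Suc k) q"
  have X: "?X (Suc k) = X" "?X k = (1 - q * s * u) * X"
    using qpoch_inf_step[of "q * s" k] by (simp_all add: X_def u_def mult_ac)
  have z: "(z * q) ^ Suc k = z * z ^ k * (q * u)"
      "(z * q\<^sup>2) ^ k = z ^ k * u\<^sup>2" "(z * q\<^sup>2) ^ Suc k = z * z ^ k * (q * u)\<^sup>2"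
    by (simp_all add: u_def power_mult_distrib power2_eq_square)
  have A: "rr_coeff (Suc k) * (1 - q * u) = u\<^sup>2 * rr_coeff k"
    unfolding u_def by (rule rr_coeff_Suc)
  \<comment> \<open>1 - (1 + s) q u + s (q u)^2 = (1 - q u)(1 - q s u): the first factor is absorbed
    by \<open>rr_coeff_Suc\<close>, the second by the infinite product.\<close>
  have alg: "R' * (z * Z) * X - (1 + s) * (R' * (z * Z * (q * u)) * X) + s * (R' * (z * Z * (q * u)\<^sup>2) * X)
      = z * (R * (Z * u\<^sup>2) * ((1 - q * s * u) * X))"
    if "R' * (1 - q * u) = u\<^sup>2 * R" for R R' Z X u :: real
    using that by algebra
  show "?P z (Suc k) - (1 + s) * ?P (z * q) (Suc k) + s * ?P (z * q\<^sup>2) (Suc k) = z * ?P (z * q\<^sup>2) k"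
    unfolding X z power_Suc[of z] by (rule alg[OF A])
qed

lemma qpoch_inf_split: "qpoch_inf v q = qpoch v q k * qpoch_inf (v * q ^ k) q"
proof (induction k)
  case (Suc k)
  then show ?case
    using qpoch_inf_step[of v k] by (simp add: qpoch_Suc)
qed simp

lemma Phi_eq_phi01:
  assumes "\<bar>v\<bar> < 1"
  shows "Phi v z = qpoch_inf v q * phi01 v q z"
proof -
  have v0: "qpoch_inf v q \<noteq> 0"
    using assms by (intro qpoch_inf_nonzero norm_q) simp
  have "(\<lambda>k. 1 / qpoch_inf v q * (rr_coeff k * z ^ k * qpoch_inf (v * q ^ k) q)) sums (1 / qpoch_inf v q * Phi v z)"
    by (intro sums_mult Phi_sums)
  moreover have "1 / qpoch_inf v q * (rr_coeff k * z ^ k * qpoch_inf (v * q ^ k) q)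
      = q ^ (k * (k - 1)) * z ^ k / (qpoch v q k * qpoch q q k)" for k
    using v0 qpoch_inf_split[of v k] by (auto simp: rr_coeff_def field_simps)
  ultimately have "phi01 v q z = 1 / qpoch_inf v q * Phi v z"
    unfolding phi01_def by (simp add: sums_iff)
  then show ?thesis
    using v0 by simp
qed

section \<open>Evaluation of the mass\<close>

lemma Phi_powser:
  "(\<lambda>n. (\<Sum>k | 2 * k \<le> n. rr_coeff k * euler_coeff q (n - 2 * k) * q ^ (k * (n - 2 * k)) * b ^ (n - 2 * k)) * c ^ n)
     sums Phi (b * c) (c\<^sup>2)"
proof -
  \<comment> \<open>Each infinite product in \<open>Phi\<close> is expanded by Euler's series. The
    double series is dominated by a product of two absolutely convergent series, because |q^k|^l <=
    1.\<close>
  define f where "f = (\<lambda>(k, l). rr_coeff k * (c\<^sup>2) ^ k * (euler_coeff q l * (b * c * q ^ k) ^ l))"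
  define u where "u k = norm (rr_coeff k * (c\<^sup>2) ^ k)" for k
  define w where "w l = norm (euler_coeff q l * (b * c) ^ l)" for l
  have inner: "((\<lambda>l. f (k, l)) has_sum (rr_coeff k * (c\<^sup>2) ^ k * qpoch_inf (b * c * q ^ k) q)) UNIV" for k
    unfolding f_def prod.case
    by (intro has_sum_cmult_right norm_summable_imp_has_sum summable_norm_euler euler_qpoch_inf norm_q)
  have "(\<lambda>(k, l). u k * w l) summable_on (UNIV \<times> UNIV)"
  proof (rule summable_on_SigmaI)
    have "summable w"
      unfolding w_def by (rule summable_norm_euler[OF norm_q])
    moreover have "(\<lambda>l. norm (w l)) = w"
      by (simp add: w_def fun_eq_iff)
    ultimately have "summable (\<lambda>l. norm (w l))" "summable w"
      by simp_all
    then have "(w has_sum suminf w) UNIV"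
      by (intro norm_summable_imp_has_sum summable_sums)
    then show "((\<lambda>l. case (k, l) of (k, l) \<Rightarrow> u k * w l) has_sum (u k * suminf w)) UNIV" for k
      unfolding prod.case by (rule has_sum_cmult_right)
    have "(\<lambda>k. u k) summable_on UNIV"
      using summable_norm_rr_coeff[of "c\<^sup>2"] by (intro norm_summable_imp_summable_on) (simp add: u_def)
    then show "(\<lambda>k. u k * suminf w) summable_on UNIV"
      by (rule summable_on_cmult_left)
  qed (auto simp: u_def w_def)
  then have uw: "(\<lambda>x. norm (case x of (k, l) \<Rightarrow> u k * w l)) summable_on (UNIV \<times> UNIV)"
    by (rule summable_on_iff_abs_summable_on_real[THEN iffD1])
  have "norm (f x) \<le> norm (case x of (k, l) \<Rightarrow> u k * w l)" for x
  proof (cases x)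
    case (Pair k l)
    have "\<bar>q ^ k\<bar> ^ l \<le> 1"
      using q_pos q_less_1 by (intro power_le_one) (auto intro: power_le_one)
    then have "norm ((b * c * q ^ k) ^ l) \<le> norm ((b * c) ^ l)"
      unfolding power_mult_distrib[of "b * c"] norm_mult using mult_left_le[of "\<bar>q ^ k\<bar> ^ l" "norm ((b * c) ^ l)"]
      by (simp add: power_abs)
    then have "norm (f x) \<le> u k * (norm (euler_coeff q l) * norm ((b * c) ^ l))"
      unfolding f_def Pair prod.case u_def norm_mult[of _ "_ * _ ^ l"] norm_mult[of "euler_coeff q l"]
      by (intro mult_left_mono mult_nonneg_nonneg) auto
    then show ?thesis
      unfolding Pair prod.case by (simp add: w_def abs_mult u_def)
  qed
  then have "(\<lambda>x. norm (f x)) summable_on (UNIV \<times> UNIV)"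
    by (intro Infinite_Sum.abs_summable_on_comparison_test[OF uw])
  then have "f summable_on (UNIV \<times> UNIV)"
    by (rule abs_summable_summable)
  then obtain S where S: "(f has_sum S) (UNIV \<times> UNIV)"
    by (auto simp: summable_on_def)
  have "((\<lambda>k. rr_coeff k * (c\<^sup>2) ^ k * qpoch_inf (b * c * q ^ k) q) has_sum S) UNIV"
    by (rule has_sum_SigmaD[OF S inner])
  then have "S = Phi (b * c) (c\<^sup>2)"
    using has_sum_imp_sums Phi_sums sums_unique2 by blast
  \<comment> \<open>Regrouping by the total power n = 2k + l of c.\<close>
  have "(f has_sum S) (UNIV \<times> UNIV)
      = ((\<lambda>(n, k). f (k, n - 2 * k)) has_sum S) (Sigma UNIV (\<lambda>n. {k. 2 * k \<le> n}))"
    by (rule has_sum_reindex_bij_witness[where j = "\<lambda>(k, l). (2 * k + l, k)" and i = "\<lambda>(n, k). (k, n - 2 * k)"]) auto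
  with S have "((\<lambda>(n, k). f (k, n - 2 * k)) has_sum S) (Sigma UNIV (\<lambda>n. {k. 2 * k \<le> n}))"
    by simp
  then have "((\<lambda>n. \<Sum>k | 2 * k \<le> n. f (k, n - 2 * k)) has_sum S) UNIV"
  proof (rule has_sum_SigmaD)
    fix n :: nat
    have "finite {k. 2 * k \<le> n}"
      by (rule finite_subset[of _ "{..n}"]) auto
    then show "((\<lambda>k. case (n, k) of (n, k) \<Rightarrow> f (k, n - 2 * k)) has_sum (\<Sum>k | 2 * k \<le> n. f (k, n - 2 * k))) {k. 2 * k \<le> n}"
      by (simp add: has_sum_finite)
  qed
  then have "(\<lambda>n. \<Sum>k | 2 * k \<le> n. f (k, n - 2 * k)) sums S"
    by (rule has_sum_imp_sums)
  moreover have "(\<Sum>k | 2 * k \<le> n. f (k, n - 2 * k))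
      = (\<Sum>k | 2 * k \<le> n. rr_coeff k * euler_coeff q (n - 2 * k) * q ^ (k * (n - 2 * k)) * b ^ (n - 2 * k)) * c ^ n" for n
    unfolding sum_distrib_right
  proof (intro sum.cong)
    fix k assume "k \<in> {k. 2 * k \<le> n}"
    then have "(c\<^sup>2) ^ k * c ^ (n - 2 * k) = c ^ n"
      by (simp flip: power_mult power_add)
    then show "f (k, n - 2 * k) = rr_coeff k * euler_coeff q (n - 2 * k) * q ^ (k * (n - 2 * k)) * b ^ (n - 2 * k) * c ^ n"
      by (simp add: f_def power_mult_distrib power_mult[symmetric] mult_ac)
  qed simp
  ultimately show ?thesis
    using \<open>S = _\<close> by simp
qed

text \<open>Both sides are power series in c with leading coefficient 1 that obey the same
  contiguous relation, so their difference falls under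
  \<open>contiguous_powser_zero\<close>.\<close>

lemma LL_one:
  assumes "0 < b" "b < 1"
  shows "LL b c (\<lambda>_. 1) = Phi (b * c) (c\<^sup>2)"
proof -
  define f where "f n b = L (\<lambda>t. self_conv (euler_coeff q) n t / E b t)" for n b
  define g where "g n b = (\<Sum>k | 2 * k \<le> n. rr_coeff k * euler_coeff q (n - 2 * k) * q ^ (k * (n - 2 * k)) * b ^ (n - 2 * k))" for n b
  have fs: "(\<lambda>n. f n b * c ^ n) sums LL b c (\<lambda>_. 1)" if "0 < b" "b < 1" for b c
    unfolding f_def by (rule LL_one_sums) (use that in simp)
  have gs: "(\<lambda>n. g n b * c ^ n) sums Phi (b * c) (c\<^sup>2)" for b c
    unfolding g_def by (rule Phi_powser)
  have "f n b - g n b = 0" for n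
  proof (rule contiguous_powser_zero[where d = "\<lambda>n b. f n b - g n b" and D = "\<lambda>b c. LL b c (\<lambda>_. 1) - Phi (b * c) (c\<^sup>2)", OF _ _ _ assms])
    fix b c :: real assume b: "0 < b" "b < 1"
    show "(\<lambda>n. (f n b - g n b) * c ^ n) sums (LL b c (\<lambda>_. 1) - Phi (b * c) (c\<^sup>2))"
      using sums_diff[OF fs[OF b] gs] by (simp add: left_diff_distrib)
    show "f 0 b - g 0 b = 0"
      using b by (simp add: f_def g_def self_conv_euler_0 euler_coeff_def)
    assume c: "c \<noteq> 0"
    \<comment> \<open>The extra factor c comes from v = bc in \<open>Phi_shift_both\<close> and is
      cancelled next.\<close>
    have "c * (b * Phi (b * c) (c\<^sup>2)) = c * (c * Phi (b * q * (c * q)) ((c * q)\<^sup>2) + (b - c) * (1 - b * c) * Phi (b * (c * q)) ((c * q)\<^sup>2))"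
      using Phi_shift_both[of "b * c" "c\<^sup>2"] by (simp add: power2_eq_square algebra_simps)
    then have "b * Phi (b * c) (c\<^sup>2) = c * Phi (b * q * (c * q)) ((c * q)\<^sup>2) + (b - c) * (1 - b * c) * Phi (b * (c * q)) ((c * q)\<^sup>2)"
      using c by simp
    then show "b * (LL b c (\<lambda>_. 1) - Phi (b * c) (c\<^sup>2))
        = c * (LL (b * q) (c * q) (\<lambda>_. 1) - Phi (b * q * (c * q)) ((c * q)\<^sup>2))
          + (b - c) * (1 - b * c) * (LL b (c * q) (\<lambda>_. 1) - Phi (b * (c * q)) ((c * q)\<^sup>2))"
      using LL_one_contiguous[of b c] b by (simp add: algebra_simps)
  qed
  then have "f n b = g n b" for n
    by simp
  then show ?thesis
    using fs[OF assms, of c] gs[of b c] sums_unique2 by simp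
qed

section \<open>Integrals of one and of two Al-Salam--Chihara polynomials\<close>

lemma LL_asc:
  assumes "0 < b" "b < 1" "c \<noteq> 0"
  shows "LL b c (\<lambda>x. al_salam_chihara m x (q / c) b q) = (- (q / c)) ^ m * q ^ (m choose 2) * Phi (b * c) (c\<^sup>2 / q ^ m)"
  using assms(1,2)
proof (induction m arbitrary: b)
  case 0
  then show ?case by (simp add: LL_one)
next
  case (Suc m)
  define a where "a = q / c"
  define K where "K = (- a) ^ m * q ^ (m choose 2)"
  define z where "z = c\<^sup>2 / q ^ Suc m"
  have bq: "0 < b * q" "b * q < 1"
    using Suc.prems q_pos abs_bq[of b] by auto
  have zq: "c\<^sup>2 / q ^ m = z * q"
    by (simp add: z_def)
  have ab: "\<bar>b\<bar> < 1"
    using Suc.prems by simp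
  \<comment> \<open>The integral of degree m is known at b and at b q; the Christoffel relation
    links both to the integral of degree m + 1 at b.\<close>
  have "K * Phi (b * q * c) (z * q) = LL (b * q) c (\<lambda>x. al_salam_chihara m x a (b * q) q)"
    using Suc.IH[OF bq] by (simp add: a_def K_def zq)
  also have "\<dots> = LL b c (\<lambda>x. (1 - a * b * q ^ m) * al_salam_chihara m x a b q + (- b) * al_salam_chihara (Suc m) x a b q)"
    unfolding LL_shift_b[OF ab, symmetric] asc_christoffel by simp
  also have "\<dots> = (1 - a * b * q ^ m) * LL b c (\<lambda>x. al_salam_chihara m x a b q) + (- b) * LL b c (\<lambda>x. al_salam_chihara (Suc m) x a b q)"
    by (subst LL_add[OF ab]) (intro continuous_intros, intro continuous_intros, simp only: LL_cmult)
  also have "LL b c (\<lambda>x. al_salam_chihara m x a b q) = K * Phi (b * c) (z * q)"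
    using Suc.IH[OF Suc.prems] by (simp add: a_def K_def zq)
  finally have "b * LL b c (\<lambda>x. al_salam_chihara (Suc m) x a b q)
      = K * ((1 - a * b * q ^ m) * Phi (b * c) (z * q) - Phi (b * c * q) (z * q))"
    by (simp add: algebra_simps)
  also have "(1 - a * b * q ^ m) * Phi (b * c) (z * q) - Phi (b * c * q) (z * q) = - (a * b * q ^ m) * Phi (b * c) z"
  proof -
    \<comment> \<open>The coupling a = q/c makes the coefficient fit \<open>Phi_shift_v\<close> at v
      = bc.\<close>
    have "z * q * (a * b * q ^ m) = q * (b * c)"
      using assms(3) by (simp add: z_def a_def power2_eq_square field_simps)
    moreover have "z * q * ((1 - A) * F1 - F2) = z * q * (- A * F0)"
      if "z * q * A = q * v" "q * v * (F1 - F0) = z * q * (F1 - F2)" for A F0 F1 F2 v :: real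
      using that by algebra
    ultimately have "z * q * ((1 - a * b * q ^ m) * Phi (b * c) (z * q) - Phi (b * c * q) (z * q)) = z * q * (- (a * b * q ^ m) * Phi (b * c) z)"
      using Phi_shift_v[of "b * c" z] by blast
    moreover have "z * q \<noteq> 0"
      using assms(3) by (simp add: z_def)
    ultimately show ?thesis
      using mult_left_cancel by blast
  qed
  also have "K * (- (a * b * q ^ m) * Phi (b * c) z) = b * ((- a) ^ Suc m * q ^ (Suc m choose 2) * Phi (b * c) z)"
    by (simp add: K_def choose_two_Suc power_add mult_ac)
  finally have "b * LL b c (\<lambda>x. al_salam_chihara (Suc m) x a b q)
      = b * ((- a) ^ Suc m * q ^ (Suc m choose 2) * Phi (b * c) z)" .
  then have "LL b c (\<lambda>x. al_salam_chihara (Suc m) x a b q) = (- a) ^ Suc m * q ^ (Suc m choose 2) * Phi (b * c) z"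
    using Suc.prems(1) mult_left_cancel[of b] by blast
  then show ?case
    unfolding a_def z_def .
qed

text \<open>The integrals and the claimed values agree for n = 0 and obey the same recurrence, found
  by expanding 2x Q_m Q_n in either index. The choice b = a s fixes bc = q s, where
  \<open>Phi_q_difference\<close> applies.\<close>

lemma LL_asc_asc:
  assumes a: "a > 0" and s: "s > 0" "s\<^sup>2 = q" and b: "b = a * s" "b < 1" and c: "c = q / a"
  shows "LL b c (\<lambda>x. al_salam_chihara m x a b q * al_salam_chihara n x a b q)
    = (- a) ^ (m + n) * q ^ ((m choose 2) + (n choose 2)) * Phi (q * s) (c\<^sup>2 / q ^ (m + n))"
proof -
  define Q where "Q m x = al_salam_chihara m x a b q" for m x
  define G where "G m n = (- a) ^ (m + n) * q ^ ((m choose 2) + (n choose 2)) * Phi (q * s) (c\<^sup>2 / q ^ (m + n))" for m n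
  \<comment> \<open>It vanishes at 0, so the truncated indices n - 1 below never matter.\<close>
  define \<gamma> where "\<gamma> n = (1 - q ^ n) * (1 - a * b * q ^ (n - 1))" for n
  have b0: "0 < b" and ab: "\<bar>b\<bar> < 1" and c0: "c \<noteq> 0" and qc: "q / c = a" and bc: "b * c = q * s"
    using a s b c q_pos by auto
  have contQ: "continuous_on UNIV (Q m)" for m
    unfolding Q_def by (intro continuous_intros)
  have x_left: "LL b c (\<lambda>x. 2 * x * (Q m x * Q n x))
      = LL b c (\<lambda>x. Q (Suc m) x * Q n x) + (a + b) * q ^ m * LL b c (\<lambda>x. Q m x * Q n x) + \<gamma> m * LL b c (\<lambda>x. Q (m - 1) x * Q n x)" for m n
  proof -
    have "(\<lambda>x. 2 * x * (Q m x * Q n x)) = (\<lambda>x. (Q (Suc m) x * Q n x + (a + b) * q ^ m * (Q m x * Q n x)) + \<gamma> m * (Q (m - 1) x * Q n x))"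
    proof
      fix x
      have "2 * x * Q m x = Q (Suc m) x + (a + b) * q ^ m * Q m x + \<gamma> m * Q (m - 1) x"
        unfolding Q_def \<gamma>_def by (rule asc_mult_x)
      then have "2 * x * Q m x * Q n x = (Q (Suc m) x + (a + b) * q ^ m * Q m x + \<gamma> m * Q (m - 1) x) * Q n x"
        by simp
      then show "2 * x * (Q m x * Q n x) = (Q (Suc m) x * Q n x + (a + b) * q ^ m * (Q m x * Q n x)) + \<gamma> m * (Q (m - 1) x * Q n x)"
        by (simp only: mult.assoc ring_distribs)
    qed
    then show ?thesis
      using contQ by (simp add: LL_add[OF ab] LL_cmult continuous_intros)
  qed
  have G_rec: "G m (Suc n) + (a + b) * q ^ n * G m n + \<gamma> n * G m (n - 1)
      = G (Suc m) n + (a + b) * q ^ m * G m n + \<gamma> m * G (m - 1) n" for m n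
  proof -
    define K where "K = (- a) ^ (m + n) * q ^ ((m choose 2) + (n choose 2))"
    define X Y where "X = q ^ m" and "Y = q ^ n"
    \<comment> \<open>Chosen so that raising an index, keeping both, or lowering one gives
      \<open>Phi\<close> the argument y, y q or y q^2.\<close>
    define y where "y = c\<^sup>2 / (q * (X * Y))"
    have XY: "X \<noteq> 0" "Y \<noteq> 0" "q ^ (m + n) = X * Y"
      by (simp_all add: X_def Y_def power_add)
    define F where "F i = Phi (q * s) (y * q ^ i)" for i :: nat
    have F: "Phi (q * s) (c\<^sup>2 / q ^ (m + n)) = F 1" "Phi (q * s) (c\<^sup>2 / q ^ Suc (m + n)) = F 0"
      by (simp_all add: F_def y_def XY)
    \<comment> \<open>Lowering an index multiplies the argument of \<open>Phi\<close> by q; at i = 0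
      both sides are zero.\<close>
    have \<gamma>G: "\<gamma> i * ((- a) ^ (i - 1 + j) * q ^ (((i - 1) choose 2) + (j choose 2)) * Phi (q * s) (c\<^sup>2 / q ^ (i - 1 + j)))
        = - ((- a) ^ (i + j) * q ^ ((i choose 2) + (j choose 2))) / a * ((1 - q ^ i) * (q / q ^ i - a * b)) * Phi (q * s) (c\<^sup>2 * q / q ^ (i + j))" for i j
    proof (cases i)
      case (Suc k)
      have "q / q ^ Suc k - a * b = (1 - a * b * q ^ k) / q ^ k"
        by (simp add: field_simps)
      moreover have "q ^ (Suc k choose 2) = q ^ k * q ^ (k choose 2)"
        by (simp add: choose_two_Suc power_add)
      moreover have "c\<^sup>2 * q / q ^ (Suc k + j) = c\<^sup>2 / q ^ (k + j)"
        by simp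
      ultimately show ?thesis
        unfolding Suc \<gamma>_def power_add[of q "_ choose 2"] using a by (simp add: mult_ac)
    qed (simp add: \<gamma>_def)
    have y2: "c\<^sup>2 * q / q ^ (m + n) = y * q\<^sup>2"
      by (simp add: y_def XY power2_eq_square)
    define P1 P2 where "P1 = ((1 - X) * (q / X - a * b)) / a * F 2" and "P2 = ((1 - Y) * (q / Y - a * b)) / a * F 2"
    have "\<gamma> m * G (m - 1) n = - K / a * ((1 - X) * (q / X - a * b)) * F 2"
      using \<gamma>G[of m n] by (simp only: G_def K_def X_def F_def y2)
    then have g1: "\<gamma> m * G (m - 1) n = - (K * P1)"
      by (simp add: P1_def)
    have "\<gamma> n * G m (n - 1) = - K / a * ((1 - Y) * (q / Y - a * b)) * F 2"
      using \<gamma>G[of n m] unfolding G_def K_def Y_def F_def y2[symmetric]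
      by (simp only: add.commute[of n m] add.commute[of "n - 1" m] add.commute[of "n choose 2"] add.commute[of "(n - 1) choose 2"])
    then have g2: "\<gamma> n * G m (n - 1) = - (K * P2)"
      by (simp add: P2_def)
    have g3: "G (Suc m) n = K * (- a) * X * F 0" "G m (Suc n) = K * (- a) * Y * F 0" "G m n = K * F 1"
      using F by (simp_all add: G_def K_def X_def Y_def choose_two_Suc power_add mult_ac)
    have qd: "F 0 - (1 + s) * F 1 + s * F 2 = y * F 2"
      using Phi_q_difference[OF s(2), of y] by (simp add: F_def)
    have y: "y * (a\<^sup>2 * (X * Y)) = q"
      using a XY by (simp add: y_def c power2_eq_square)
    have "a * (X * Y) * (- a * Y * F 0 + (a + b) * Y * F 1 - ((1 - Y) * (q / Y - a * b)) / a * F 2)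
        = - a\<^sup>2 * X * Y * Y * F 0 + a * (a + b) * X * Y * Y * F 1 - X * ((1 - Y) * (q - a * b * Y)) * F 2"
      using a XY by (simp add: field_simps power2_eq_square)
    \<comment> \<open>The two sides differ by a^2 X Y (X - Y) times the q-difference equation
      \<open>qd\<close>.\<close>
    also have "\<dots> = - a\<^sup>2 * X * Y * X * F 0 + a * (a + b) * X * Y * X * F 1 - Y * ((1 - X) * (q - a * b * X)) * F 2"
      unfolding b(1) using qd y by algebra
    also have "\<dots> = a * (X * Y) * (- a * X * F 0 + (a + b) * X * F 1 - ((1 - X) * (q / X - a * b)) / a * F 2)"
      using a XY by (simp add: field_simps power2_eq_square)
    finally have "- a * Y * F 0 + (a + b) * Y * F 1 - P2 = - a * X * F 0 + (a + b) * X * F 1 - P1"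
      unfolding P1_def P2_def using a XY by simp
    then show ?thesis
      unfolding g1 g2 g3 X_def[symmetric] Y_def[symmetric] by algebra
  qed
  have "LL b c (\<lambda>x. Q m x * Q n x) = G m n" for m n
  proof (induction n arbitrary: m rule: less_induct)
    case (less n)
    show ?case
    proof (cases n)
      case 0
      then show ?thesis
        using LL_asc[OF b0 b(2) c0, of m] by (simp add: Q_def G_def qc bc)
    next
      case (Suc k)
      have *: "\<gamma> k * LL b c (\<lambda>x. Q m x * Q (k - 1) x) = \<gamma> k * G m (k - 1)"
      proof (cases "k = 0")
        case False
        then show ?thesis
          using less[of "k - 1" m] Suc by simp
      qed (simp add: \<gamma>_def)
      have comm: "LL b c (\<lambda>x. Q i x * Q j x) = LL b c (\<lambda>x. Q j x * Q i x)" for i j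
        by (simp only: mult.commute)
      have "LL b c (\<lambda>x. 2 * x * (Q k x * Q m x))
          = LL b c (\<lambda>x. Q m x * Q (Suc k) x) + (a + b) * q ^ k * G m k + \<gamma> k * G m (k - 1)"
        unfolding x_left comm[of "Suc k" m] comm[of k m] comm[of "k - 1" m] * using less[of k m] Suc by simp
      then have "LL b c (\<lambda>x. Q m x * Q (Suc k) x) + (a + b) * q ^ k * G m k + \<gamma> k * G m (k - 1)
          = LL b c (\<lambda>x. 2 * x * (Q m x * Q k x))"
        by (simp only: mult.commute[of "Q k _"])
      also have "\<dots> = G (Suc m) k + (a + b) * q ^ m * G m k + \<gamma> m * G (m - 1) k"
        unfolding x_left using less[of k] Suc by simp
      finally show ?thesis
        using G_rec[of m k] Suc by simp
    qed
  qed
  then show ?thesis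
    by (simp add: Q_def G_def)
qed

end

section \<open>Specialisation to the continuous q-Laguerre parameters\<close>

theorem mainTheorem5:
  fixes q \<alpha> :: real and m n :: nat
  assumes "0 < q" and "q < 1" and "\<alpha> > -1"
  shows "qpoch_inf q q / (2 * pi * qpoch_inf (q powr (3 / 2)) q) *
      integral {0..pi} (\<lambda>\<theta>.
        cont_q_laguerre m \<alpha> (cos \<theta>) q * cont_q_laguerre n \<alpha> (cos \<theta>) q *
        (cmod (qpoch_inf (exp (2 * \<i> * complex_of_real \<theta>)) (complex_of_real q) *
               qpoch_inf (complex_of_real (q powr (3 / 4 - \<alpha> / 2)) * exp (\<i> * complex_of_real \<theta>))
                 (complex_of_real q) /
               qpoch_inf (complex_of_real (q powr (3 / 4 + \<alpha> / 2)) * exp (\<i> * complex_of_real \<theta>))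
                 (complex_of_real q))) ^ 2)
    = (-1) ^ (m + n) *
      (q powr ((\<alpha> + 1 / 2) * (real m + real n)
               + real m * (real m - 1) / 2 + real n * (real n - 1) / 2)
       / (qpoch q q m * qpoch q q n)) *
      phi01 (q powr (3 / 2)) q (q powr (- real m - real n - \<alpha> + 3 / 2))"
proof -
  interpret q_base q
    using assms by unfold_locales
  define a where "a = q powr (\<alpha> / 2 + 1 / 4)"
  define s where "s = q powr (1 / 2)"
  define b where "b = q powr (3 / 4 + \<alpha> / 2)"
  define c where "c = q powr (3 / 4 - \<alpha> / 2)"
  define v where "v = q powr (3 / 2)"
  define Q where "Q k x = al_salam_chihara k x a b q" for k x
  have a: "a > 0" and s: "s > 0" "s\<^sup>2 = q"
    using assms by (simp_all add: a_def s_def power2_eq_square flip: powr_add)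
  \<comment> \<open>From \<alpha> > -1 the exponent 3/4 + \<alpha>/2 is positive, which gives b <
    1.\<close>
  have b: "b = a * s" and b1: "b < 1"
    using assms powr_less_mono'[of q 0 "3 / 4 + \<alpha> / 2"]
    by (simp_all add: a_def s_def b_def add_ac flip: powr_add)
  have c: "c = q / a"
  proof -
    have "c * a = q"
      using assms by (simp add: a_def c_def flip: powr_add)
    then show ?thesis
      using a by (simp add: field_simps)
  qed
  have v: "v = q * s" and v1: "\<bar>v\<bar> < 1"
    using assms powr_less_mono'[of q 0 "3 / 2"] powr_mult_base[of q "1 / 2"]
    by (simp_all add: s_def v_def)
  have v0: "qpoch_inf v q \<noteq> 0"
    using v1 by (intro qpoch_inf_nonzero norm_q) simp
  have lag: "cont_q_laguerre k \<alpha> x q = a ^ k / qpoch q q k * Q k x" for k x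
    unfolding cont_q_laguerre_def Let_def a_def[symmetric] s_def[symmetric] b[symmetric] Q_def ..
  have "integral {0..pi} (\<lambda>\<theta>.
        cont_q_laguerre m \<alpha> (cos \<theta>) q * cont_q_laguerre n \<alpha> (cos \<theta>) q *
        (cmod (qpoch_inf (exp (2 * \<i> * complex_of_real \<theta>)) (complex_of_real q) *
               qpoch_inf (complex_of_real c * exp (\<i> * complex_of_real \<theta>)) (complex_of_real q) /
               qpoch_inf (complex_of_real b * exp (\<i> * complex_of_real \<theta>)) (complex_of_real q))) ^ 2)
      = integral {0..pi} (\<lambda>\<theta>. a ^ (m + n) / (qpoch q q m * qpoch q q n) *
          ((Q m (cos \<theta>) * Q n (cos \<theta>)) * (E c \<theta> / E b \<theta>) * gw \<theta>))"
    unfolding lag by (simp add: norm_mult norm_divide power_mult_distrib power_divide E_def gw_def power_add mult_ac)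
  also have "\<dots> = a ^ (m + n) / (qpoch q q m * qpoch q q n) * (2 * pi / qpoch_inf q q * LL b c (\<lambda>x. Q m x * Q n x))"
    unfolding integral_mult_right using qpoch_inf_q_pos by (simp add: LL_def L_def)
  also have "LL b c (\<lambda>x. Q m x * Q n x)
      = (- a) ^ (m + n) * q ^ ((m choose 2) + (n choose 2)) * (qpoch_inf v q * phi01 v q (c\<^sup>2 / q ^ (m + n)))"
    unfolding Q_def LL_asc_asc[OF a s b b1 c] v[symmetric] Phi_eq_phi01[OF v1] ..
  finally have main: "qpoch_inf q q / (2 * pi * qpoch_inf v q) * integral {0..pi} (\<lambda>\<theta>.
        cont_q_laguerre m \<alpha> (cos \<theta>) q * cont_q_laguerre n \<alpha> (cos \<theta>) q *
        (cmod (qpoch_inf (exp (2 * \<i> * complex_of_real \<theta>)) (complex_of_real q) *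
               qpoch_inf (complex_of_real c * exp (\<i> * complex_of_real \<theta>)) (complex_of_real q) /
               qpoch_inf (complex_of_real b * exp (\<i> * complex_of_real \<theta>)) (complex_of_real q))) ^ 2)
      = a ^ (m + n) * (- a) ^ (m + n) * q ^ ((m choose 2) + (n choose 2)) / (qpoch q q m * qpoch q q n)
        * phi01 v q (c\<^sup>2 / q ^ (m + n))"
    using v0 qpoch_inf_q_pos by simp
  have ch: "q ^ (k choose 2) = q powr (real k * (real k - 1) / 2)" for k
  proof -
    have "real (k choose 2) = real k * (real k - 1) / 2"
      by (induction k) (simp_all add: choose_two_Suc field_simps)
    from this[symmetric] show ?thesis
      using assms by (simp only: powr_realpow)
  qed
  \<comment> \<open>The factor a^(m+n) comes from the normalisation of the two Laguerre polynomials,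
    (-a)^(m+n) from the integral.\<close>
  have aa: "a ^ (m + n) * (- a) ^ (m + n) = (-1) ^ (m + n) * q powr ((\<alpha> + 1 / 2) * (real m + real n))"
  proof -
    have "a ^ (m + n) * (- a) ^ (m + n) = (- 1) ^ (m + n) * (a * a) ^ (m + n)"
      unfolding power_minus[of a] power_mult_distrib by simp
    also have "a * a = q powr (\<alpha> + 1 / 2)"
      by (simp add: a_def flip: powr_add)
    also have "(q powr (\<alpha> + 1 / 2)) ^ (m + n) = q powr ((\<alpha> + 1 / 2) * (real m + real n))"
      using assms by (simp add: powr_powr flip: powr_realpow)
    finally show ?thesis .
  qed
  have z: "c\<^sup>2 / q ^ (m + n) = q powr (- real m - real n - \<alpha> + 3 / 2)"
    using assms unfolding c_def power2_eq_square
    by (simp flip: powr_add powr_diff powr_realpow) (simp add: algebra_simps)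
  show ?thesis
    unfolding b_def[symmetric] c_def[symmetric] v_def[symmetric] main aa z power_add[of q "m choose 2"] ch
    by (simp add: powr_add mult_ac)
qed

end
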